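(* Let $k$ be a field of characteristic zero, let $n\ge 1$, let $L_0,\ldots,L_r\in k[X_0,\ldots,X_n]$ be nonzero, pairwise non-proportional linear forms, let $n_0,\ldots,n_r\ge 1$ be integers, and let $F=\prod_{i=0}^{r}L_i^{n_i}$. Then $F$ is homaloidal if and only if the polynomial $F_{red}=\prod_{i=0}^{r}L_i$ is homaloidal. In particular, if $F$ is homaloidal, then $r=n$, the linear forms $L_0,\ldots,L_n$ are linearly independent, and the map $\partial F:\mathbb{P}^n\dashrightarrow\mathbb{P}^{n*}$ is a composition of projectivities and of a standard Cremona transformation.
   Context: Let $\mathbb{P}^n$ be projective space over a field $k$ of characteristic zero with homogeneous coordinates $X_0,\ldots,X_n$. For a homogeneous polynomial $F$ of degree $d\ge 1$, the polar map of $F$ is the rational map $\partial F:\mathbb{P}^n\dashrightarrow\mathbb{P}^{n*}$, $p\mapsto\left[\frac{\partial F}{\partial X_0}(p):\cdots:\frac{\partial F}{\partial X_n}(p)\right]$, and the polar system $|\partial F|$ is the linear system spanned by the partial derivatives of $F$. Its moving part $|M(\partial F)|$ is the linear system obtained by removing all base components, i.e. by dividing all the partial derivatives by their greatest common divisor; it induces the same rational map. The polynomial $F$ is called homaloidal if the rational map $\mathbb{P}^n\dashrightarrow\mathbb{P}^{n*}$ induced by $|M(\partial F)|$ is birational. A projectivity is an isomorphism between projective spaces induced by an invertible linear map. A standard Cremona transformation is a map which, with respect to some system of homogeneous coordinates $Y_0,\ldots,Y_n$ on the source and a corresponding choice of homogeneous coordinates on the target, is the polar map of $Y_0\cdots Y_n$,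 i.e. $[y_0:\cdots:y_n]\mapsto\left[\prod_{i\ne 0}y_i:\cdots:\prod_{i\neq n}y_i\right]$. *)

theory Defs
  imports "HOL-Library.Poly_Mapping" "Jordan_Normal_Form.Matrix"
begin

text \<open>
  A polynomial is a finitely supported function from monomials to coefficients, a monomial being
  a finitely supported function from variable indices to exponents.  The ambient ring has
  countably many variables; \<open>polys n\<close> is its subring $k[X_0,\ldots,X_n]$.
\<close>

type_synonym 'k mpoly = "(nat \<Rightarrow>\<^sub>0 nat) \<Rightarrow>\<^sub>0 'k"

definition const :: "'k::field_char_0 \<Rightarrow> 'k mpoly" where
  "const c = Poly_Mapping.single 0 c"

definition Var :: "nat \<Rightarrow> 'k::field_char_0 mpoly" where
  "Var i = Poly_Mapping.single (Poly_Mapping.single i 1) 1"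

definition polys :: "nat \<Rightarrow> 'k::field_char_0 mpoly set" where
  "polys n = {p. \<forall>m \<in> Poly_Mapping.keys p. Poly_Mapping.keys m \<subseteq> {..n}}"

definition mdeg :: "(nat \<Rightarrow>\<^sub>0 nat) \<Rightarrow> nat" where
  "mdeg m = (\<Sum>i \<in> Poly_Mapping.keys m. Poly_Mapping.lookup m i)"

text \<open>The zero polynomial is homogeneous of every degree.\<close>

definition homogeneous :: "nat \<Rightarrow> nat \<Rightarrow> 'k::field_char_0 mpoly \<Rightarrow> bool" where
  "homogeneous n d p \<longleftrightarrow> p \<in> polys n \<and> (\<forall>m \<in> Poly_Mapping.keys p. mdeg m = d)"

abbreviation linear_form :: "nat \<Rightarrow> 'k::field_char_0 mpoly \<Rightarrow> bool" where
  "linear_form n p \<equiv> homogeneous n 1 p"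

text \<open>
  In \<open>pderiv_var\<close> the subtraction of monomials is truncated, but the terms where this matters have
  coefficient \<open>0\<close>.
\<close>

definition pderiv_var :: "nat \<Rightarrow> 'k::field_char_0 mpoly \<Rightarrow> 'k mpoly" where
  "pderiv_var i p = (\<Sum>m \<in> Poly_Mapping.keys p.
     Poly_Mapping.single (m - Poly_Mapping.single i 1)
       (of_nat (Poly_Mapping.lookup m i) * Poly_Mapping.lookup p m))"

text \<open>\<open>subst_poly G p\<close> is the polynomial \<open>p(G 0, G 1, \<dots>)\<close>.\<close>

definition subst_poly :: "(nat \<Rightarrow> 'k::field_char_0 mpoly) \<Rightarrow> 'k mpoly \<Rightarrow> 'k mpoly" where
  "subst_poly G p = (\<Sum>m \<in> Poly_Mapping.keys p.
     const (Poly_Mapping.lookup p m) *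
       (\<Prod>i \<in> Poly_Mapping.keys m. G i ^ Poly_Mapping.lookup m i))"

text \<open>
  A rational map from $\mathbb{P}^n$ to a projective space of dimension $n$ is represented by the
  tuple \<open>G 0, \<dots>, G n\<close> of its components: forms of one common degree, not all zero.  (Values of
  \<open>G\<close> at indices above \<open>n\<close> are irrelevant.)  Two tuples represent the same rational map iff they
  are proportional over the field of rational functions.  The space $\mathbb{P}^{n*}$ carries the
  homogeneous coordinates dual to $X_0,\ldots,X_n$.
\<close>

definition rational_map :: "nat \<Rightarrow> (nat \<Rightarrow> 'k::field_char_0 mpoly) \<Rightarrow> bool" where
  "rational_map n G \<longleftrightarrow> (\<exists>d. \<forall>i\<le>n. homogeneous n d (G i)) \<and> (\<exists>i\<le>n. G i \<noteq> 0)"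

definition same_rational_map ::
  "nat \<Rightarrow> (nat \<Rightarrow> 'k::field_char_0 mpoly) \<Rightarrow> (nat \<Rightarrow> 'k mpoly) \<Rightarrow> bool" where
  "same_rational_map n G H \<longleftrightarrow> rational_map n G \<and> rational_map n H \<and>
     (\<forall>i\<le>n. \<forall>j\<le>n. G i * H j = G j * H i)"

text \<open>
  The composition \<open>G\<close> after \<open>H\<close>.  It is defined as a rational map when the resulting tuple is not
  identically zero; \<open>same_rational_map\<close> includes this condition.
\<close>

definition rat_comp ::
  "(nat \<Rightarrow> 'k::field_char_0 mpoly) \<Rightarrow> (nat \<Rightarrow> 'k mpoly) \<Rightarrow> nat \<Rightarrow> 'k mpoly" where
  "rat_comp G H = (\<lambda>i. subst_poly H (G i))"

text \<open>The identity map is represented by the tuple \<open>Var\<close>.\<close>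

definition birational :: "nat \<Rightarrow> (nat \<Rightarrow> 'k::field_char_0 mpoly) \<Rightarrow> bool" where
  "birational n G \<longleftrightarrow> rational_map n G \<and>
     (\<exists>H. rational_map n H \<and>
        same_rational_map n (rat_comp H G) Var \<and>
        same_rational_map n (rat_comp G H) Var)"

definition polar_map :: "'k::field_char_0 mpoly \<Rightarrow> nat \<Rightarrow> 'k mpoly" where
  "polar_map F = (\<lambda>i. pderiv_var i F)"

text \<open>
  Divisors in the ambient ring of a nonzero element of \<open>polys n\<close> lie in \<open>polys n\<close>, so divisibility
  in the ambient ring is the right notion here.
\<close>

definition is_gcd :: "nat \<Rightarrow> (nat \<Rightarrow> 'k::field_char_0 mpoly) \<Rightarrow> 'k mpoly \<Rightarrow> bool" where
  "is_gcd n G g \<longleftrightarrow> g \<in> polys n \<and> (\<forall>i\<le>n. g dvd G i) \<and>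
     (\<forall>h. (\<forall>i\<le>n. h dvd G i) \<longrightarrow> h dvd g)"

text \<open>
  \<open>M\<close> is obtained from \<open>G\<close> by removing the base components.  It is determined by \<open>G\<close> up to a
  nonzero constant factor, as \<open>g\<close> is.
\<close>

definition moving_part ::
  "nat \<Rightarrow> (nat \<Rightarrow> 'k::field_char_0 mpoly) \<Rightarrow> (nat \<Rightarrow> 'k mpoly) \<Rightarrow> bool" where
  "moving_part n G M \<longleftrightarrow> (\<exists>g. g \<noteq> 0 \<and> is_gcd n G g \<and> (\<forall>i\<le>n. G i = g * M i))"

definition homaloidal :: "nat \<Rightarrow> 'k::field_char_0 mpoly \<Rightarrow> bool" where
  "homaloidal n F \<longleftrightarrow> (\<exists>d\<ge>1. homogeneous n d F) \<and>
     (\<exists>M. moving_part n (polar_map F) M \<and> birational n M)"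

definition linear_map :: "nat \<Rightarrow> 'k::field_char_0 mat \<Rightarrow> nat \<Rightarrow> 'k mpoly" where
  "linear_map n A = (\<lambda>i. \<Sum>j\<le>n. const (A $$ (i, j)) * Var j)"

definition projectivity :: "nat \<Rightarrow> (nat \<Rightarrow> 'k::field_char_0 mpoly) \<Rightarrow> bool" where
  "projectivity n G \<longleftrightarrow> (\<exists>A \<in> carrier_mat (n + 1) (n + 1). invertible_mat A \<and>
     same_rational_map n G (linear_map n A))"

definition cremona_tuple :: "nat \<Rightarrow> nat \<Rightarrow> 'k::field_char_0 mpoly" where
  "cremona_tuple n = (\<lambda>i. \<Prod>j \<in> {..n} - {i}. Var j)"

text \<open>
  Let \<open>Y = B X\<close> be homogeneous coordinates on the source.  If \<open>\<eta>\<close> are the dual coordinates on the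
  target, then the coordinates dual to \<open>X\<close> are \<open>B\<^sup>T \<eta>\<close>; hence the map that reads
  \<open>\<eta>\<^sub>i = \<Prod>\<^sub>j\<^sub>\<noteq>\<^sub>i Y\<^sub>j\<close> is \<open>B\<^sup>T\<close> after \<open>cremona_tuple\<close> after \<open>B\<close>.  By the chain rule this is the polar map
  of \<open>Y\<^sub>0 \<cdots> Y\<^sub>n\<close>, regarded as a polynomial in \<open>X\<close>.
\<close>

definition standard_cremona :: "nat \<Rightarrow> (nat \<Rightarrow> 'k::field_char_0 mpoly) \<Rightarrow> bool" where
  "standard_cremona n G \<longleftrightarrow> (\<exists>B \<in> carrier_mat (n + 1) (n + 1). invertible_mat B \<and>
     same_rational_map n G
       (rat_comp (linear_map n (transpose_mat B)) (rat_comp (cremona_tuple n) (linear_map n B))))"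

end

theory Submission
  imports Defs
begin

text \<open>
  Put \<open>w\<^sub>i = \<Prod>\<^sub>k\<^sub>\<noteq>\<^sub>i L\<^sub>k\<close>, that is \<open>1 / L\<^sub>i\<close> up to a common factor.  The polar map of \<open>\<Prod>\<^sub>i L\<^sub>i ^ e\<^sub>i\<close> is
  given by the linear combinations \<open>N\<^sub>j = \<Sum>\<^sub>i e\<^sub>i a\<^sub>i\<^sub>j w\<^sub>i\<close>, where \<open>L\<^sub>i = \<Sum>\<^sub>j a\<^sub>i\<^sub>j X\<^sub>j\<close>.  Because the weights
  \<open>e\<^sub>i\<close> are positive and the characteristic is zero, every \<open>w\<^sub>i\<close> is nilpotent modulo the ideal generated
  by the \<open>N\<^sub>j\<close> in \<open>k[w\<^sub>0, \<dots>, w\<^sub>r]\<close>, which is therefore a finite module over \<open>k[N\<^sub>0, \<dots>, N\<^sub>n]\<close>.  If the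
  polar map is birational, then the \<open>N\<^sub>j\<close> are algebraically independent and each \<open>w\<^sub>i\<close> is a fraction in
  them.  A polynomial ring is completely integrally closed, so \<open>w\<^sub>i\<close> is a polynomial in the \<open>N\<^sub>j\<close>, hence
  for reasons of degree a linear combination of them.  As the \<open>w\<^sub>i\<close> are linearly independent, the matrix
  \<open>(e\<^sub>i a\<^sub>i\<^sub>j)\<close> is invertible: \<open>r = n\<close>, and the \<open>L\<^sub>i\<close> are linearly independent.  This condition does not
  involve the exponents, and it is sufficient, because then the polar map is a linear map after the
  standard Cremona transformation in the coordinates \<open>L\<^sub>i\<close>.
\<close>

subsection \<open>Polynomials and substitution\<close>

lemma const_0 [simp]: "const 0 = 0"
  and const_1 [simp]: "const 1 = 1"
  by (simp_all add: const_def)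

lemma const_add: "const (a + b) = const a + const b"
  by (simp add: const_def single_add)

lemma const_uminus: "const (- a) = - const a"
  by (simp add: const_def single_uminus)

lemma const_diff: "const (a - b) = const a - const b"
  by (simp add: const_def single_diff)

lemma const_mult: "const (a * b) = const a * const b"
  by (simp add: const_def mult_single)

lemma const_sum: "const (sum f A) = (\<Sum>i\<in>A. const (f i))"
  by (induction A rule: infinite_finite_induct) (simp_all add: const_add)

lemma const_of_nat [simp]: "const (of_nat n) = of_nat n"
  by (simp add: const_def)

lemma const_eq_iff [simp]: "const a = const b \<longleftrightarrow> a = b"
  unfolding const_def by (metis lookup_single_eq)

lemma single_1_eq_iff [simp]:
  "Poly_Mapping.single i (Suc 0) = Poly_Mapping.single j (Suc 0) \<longleftrightarrow> i = j"
  by (metis keys_single singleton_inject zero_less_Suc less_numeral_extra(3))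

lemma const_eq_0_iff [simp]: "const a = 0 \<longleftrightarrow> a = 0"
  using const_eq_iff[of a 0] by simp

lemma Var_neq_0 [simp]: "(Var i :: 'k::field_char_0 mpoly) \<noteq> 0"
  unfolding Var_def by (metis lookup_single_eq lookup_zero zero_neq_one)

definition eval_mon :: "(nat \<Rightarrow> 'k::field_char_0 mpoly) \<Rightarrow> (nat \<Rightarrow>\<^sub>0 nat) \<Rightarrow> 'k mpoly" where
  "eval_mon G m = (\<Prod>i \<in> Poly_Mapping.keys m. G i ^ Poly_Mapping.lookup m i)"

lemma eval_mon_superset:
  assumes "finite S" "Poly_Mapping.keys m \<subseteq> S"
  shows "eval_mon G m = (\<Prod>i\<in>S. G i ^ Poly_Mapping.lookup m i)"
  unfolding eval_mon_def using assms
  by (intro prod.mono_neutral_left) (auto simp: in_keys_iff)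

lemma mdeg_superset:
  assumes "finite S" "Poly_Mapping.keys m \<subseteq> S"
  shows "mdeg m = (\<Sum>i\<in>S. Poly_Mapping.lookup m i)"
  unfolding mdeg_def using assms
  by (intro sum.mono_neutral_left) (auto simp: in_keys_iff)

lemma keys_add_nat: "Poly_Mapping.keys (m + m' :: nat \<Rightarrow>\<^sub>0 nat) = Poly_Mapping.keys m \<union> Poly_Mapping.keys m'"
  by (auto simp: in_keys_iff lookup_add)

lemma eval_mon_add: "eval_mon G (m + m') = eval_mon G m * eval_mon G m'"
proof -
  let ?S = "Poly_Mapping.keys m \<union> Poly_Mapping.keys m'"
  have "eval_mon G (m + m') = (\<Prod>i\<in>?S. G i ^ Poly_Mapping.lookup (m + m') i)"
    by (rule eval_mon_superset) (auto simp: keys_add_nat)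
  also have "\<dots> = (\<Prod>i\<in>?S. G i ^ Poly_Mapping.lookup m i) * (\<Prod>i\<in>?S. G i ^ Poly_Mapping.lookup m' i)"
    by (simp add: lookup_add power_add prod.distrib)
  also have "\<dots> = eval_mon G m * eval_mon G m'"
    by (simp add: eval_mon_superset[of ?S])
  finally show ?thesis .
qed

lemma mdeg_add: "mdeg (m + m') = mdeg m + mdeg m'"
proof -
  let ?S = "Poly_Mapping.keys m \<union> Poly_Mapping.keys m'"
  have "mdeg (m + m') = (\<Sum>i\<in>?S. Poly_Mapping.lookup (m + m') i)"
    by (rule mdeg_superset) (auto simp: keys_add_nat)
  also have "\<dots> = mdeg m + mdeg m'"
    by (simp add: lookup_add sum.distrib mdeg_superset[of ?S])
  finally show ?thesis .
qed

lemma mdeg_0 [simp]: "mdeg 0 = 0"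
  by (simp add: mdeg_def)

lemma mdeg_single [simp]: "mdeg (Poly_Mapping.single i a) = a"
  by (cases "a = 0") (simp_all add: mdeg_def)

lemma eval_mon_0 [simp]: "eval_mon G 0 = 1"
  by (simp add: eval_mon_def)

lemma eval_mon_single [simp]: "eval_mon G (Poly_Mapping.single i a) = G i ^ a"
  by (cases "a = 0") (simp_all add: eval_mon_def)

lemma subst_poly_mon:
  "subst_poly G p = (\<Sum>m \<in> Poly_Mapping.keys p. const (Poly_Mapping.lookup p m) * eval_mon G m)"
  by (simp add: subst_poly_def eval_mon_def)

lemma subst_poly_superset:
  assumes "finite S" "Poly_Mapping.keys p \<subseteq> S"
  shows "subst_poly G p = (\<Sum>m\<in>S. const (Poly_Mapping.lookup p m) * eval_mon G m)"
  unfolding subst_poly_mon using assms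
  by (intro sum.mono_neutral_left) (auto simp: in_keys_iff)

lemma mpoly_sum_single:
  "p = (\<Sum>m \<in> Poly_Mapping.keys p. Poly_Mapping.single m (Poly_Mapping.lookup p m))"
proof (rule poly_mapping_eqI)
  fix k
  show "Poly_Mapping.lookup p k =
    Poly_Mapping.lookup (\<Sum>m \<in> Poly_Mapping.keys p. Poly_Mapping.single m (Poly_Mapping.lookup p m)) k"
    by (auto simp: lookup_sum lookup_single when_def in_keys_iff)
qed

lemma subst_poly_single: "subst_poly G (Poly_Mapping.single m c) = const c * eval_mon G m"
  by (subst subst_poly_superset[of "{m}"]) auto

lemma subst_poly_0 [simp]: "subst_poly G 0 = 0"
  by (simp add: subst_poly_def)

lemma subst_poly_const [simp]: "subst_poly G (const c) = const c"
  unfolding const_def[of c] by (subst subst_poly_single) (simp add: const_def)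

lemma subst_poly_1 [simp]: "subst_poly G 1 = 1"
  using subst_poly_const[of G 1] by simp

lemma subst_poly_of_nat [simp]: "subst_poly G (of_nat k) = of_nat k"
  using subst_poly_const[of G "of_nat k"] by simp

lemma subst_poly_Var [simp]: "subst_poly G (Var i) = G i"
  by (simp add: Var_def subst_poly_single)

lemma subst_poly_add: "subst_poly G (p + q) = subst_poly G p + subst_poly G q"
proof -
  let ?S = "Poly_Mapping.keys p \<union> Poly_Mapping.keys q"
  have "subst_poly G (p + q) = (\<Sum>m\<in>?S. const (Poly_Mapping.lookup (p + q) m) * eval_mon G m)"
    by (rule subst_poly_superset) (use keys_add[of p q] in auto)
  also have "\<dots> = subst_poly G p + subst_poly G q"
    by (simp add: lookup_add const_add distrib_right sum.distrib subst_poly_superset[of ?S])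
  finally show ?thesis .
qed

lemma subst_poly_sum: "subst_poly G (sum f A) = (\<Sum>i\<in>A. subst_poly G (f i))"
  by (induction A rule: infinite_finite_induct) (simp_all add: subst_poly_add)

lemma subst_poly_mult: "subst_poly G (p * q) = subst_poly G p * subst_poly G q"
proof -
  let ?s = "\<lambda>p m. Poly_Mapping.single m (Poly_Mapping.lookup p m)"
  have "subst_poly G (p * q)
      = subst_poly G (\<Sum>m\<in>Poly_Mapping.keys p. \<Sum>m'\<in>Poly_Mapping.keys q. ?s p m * ?s q m')"
    by (subst mpoly_sum_single[of p], subst mpoly_sum_single[of q]) (simp add: sum_product)
  also have "\<dots> = (\<Sum>m\<in>Poly_Mapping.keys p. \<Sum>m'\<in>Poly_Mapping.keys q.
      (const (Poly_Mapping.lookup p m) * eval_mon G m) * (const (Poly_Mapping.lookup q m') * eval_mon G m'))"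
    by (simp add: subst_poly_sum mult_single subst_poly_single eval_mon_add const_mult mult_ac)
  also have "\<dots> = subst_poly G p * subst_poly G q"
    by (simp add: subst_poly_mon sum_product)
  finally show ?thesis .
qed

lemma subst_poly_uminus: "subst_poly G (- p) = - subst_poly G p"
  using subst_poly_add[of G p "- p"] by (simp add: eq_neg_iff_add_eq_0 add.commute)

lemma subst_poly_diff: "subst_poly G (p - q) = subst_poly G p - subst_poly G q"
  using subst_poly_add[of G p "- q"] by (simp add: subst_poly_uminus)

lemma subst_poly_power: "subst_poly G (p ^ k) = subst_poly G p ^ k"
  by (induction k) (simp_all add: subst_poly_mult)

lemma subst_poly_prod: "subst_poly G (prod f A) = (\<Prod>i\<in>A. subst_poly G (f i))"
  by (induction A rule: infinite_finite_induct) (simp_all add: subst_poly_mult)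

lemmas subst_poly_hom =
  subst_poly_add subst_poly_diff subst_poly_uminus subst_poly_mult subst_poly_power
  subst_poly_sum subst_poly_prod

lemma eval_mon_Var: "eval_mon Var m = Poly_Mapping.single m (1 :: 'k::field_char_0)"
proof -
  have *: "Var i ^ a = Poly_Mapping.single (Poly_Mapping.single i a) (1 :: 'k)" for i a
    by (induction a) (simp_all add: Var_def mult_single flip: single_add)
  have "finite S \<Longrightarrow> (\<Prod>i\<in>S. Poly_Mapping.single (f i) (1 :: 'k)) = Poly_Mapping.single (\<Sum>i\<in>S. f i) 1"
    for S :: "nat set" and f :: "nat \<Rightarrow> nat \<Rightarrow>\<^sub>0 nat"
    by (induction S rule: finite_induct) (simp_all add: mult_single)
  moreover have "m = (\<Sum>i\<in>Poly_Mapping.keys m. Poly_Mapping.single i (Poly_Mapping.lookup m i))"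
    by (rule poly_mapping_eqI) (auto simp: lookup_sum lookup_single when_def in_keys_iff)
  ultimately show ?thesis
    unfolding eval_mon_def * by simp
qed

lemma subst_poly_Var_id [simp]: "subst_poly Var p = p"
  unfolding subst_poly_mon eval_mon_Var
  by (subst (3) mpoly_sum_single) (simp add: const_def mult_single)

lemma subst_poly_mon_subst: "subst_poly G (eval_mon H m) = eval_mon (\<lambda>i. subst_poly G (H i)) m"
  by (simp add: eval_mon_def subst_poly_hom)

lemma subst_poly_subst_poly:
  "subst_poly G (subst_poly H p) = subst_poly (\<lambda>i. subst_poly G (H i)) p"
  by (simp add: subst_poly_mon[of _ p] subst_poly_hom subst_poly_mon_subst)

lemma subst_poly_cong:
  assumes "p \<in> polys n" "\<And>i. i \<le> n \<Longrightarrow> G i = H i"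
  shows "subst_poly G p = subst_poly H p"
  unfolding subst_poly_def using assms
  by (intro sum.cong prod.cong refl arg_cong2[of _ _ _ _ "(*)"]) (force simp: polys_def)

lemma homogeneousD:
  assumes "homogeneous n d p" "m \<in> Poly_Mapping.keys p"
  shows "mdeg m = d" "Poly_Mapping.keys m \<subseteq> {..n}"
  using assms by (auto simp: homogeneous_def polys_def)

lemma homogeneousI:
  assumes "\<And>m. m \<in> Poly_Mapping.keys p \<Longrightarrow> mdeg m = d \<and> Poly_Mapping.keys m \<subseteq> {..n}"
  shows "homogeneous n d p"
  using assms by (auto simp: homogeneous_def polys_def)

lemma homogeneous_polys: "homogeneous n d p \<Longrightarrow> p \<in> polys n"
  by (simp add: homogeneous_def)

lemma homogeneous_0 [simp]: "homogeneous n d 0"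
  by (simp add: homogeneous_def polys_def)

lemma homogeneous_const [simp]: "homogeneous n 0 (const c)"
  by (rule homogeneousI) (auto simp: const_def split: if_splits)

lemma homogeneous_1 [simp]: "homogeneous n 0 1"
  using homogeneous_const[of n 1] by simp

lemma homogeneous_Var: "i \<le> n \<Longrightarrow> homogeneous n 1 (Var i)"
  by (rule homogeneousI) (auto simp: Var_def)

lemma homogeneous_add: "homogeneous n d p \<Longrightarrow> homogeneous n d q \<Longrightarrow> homogeneous n d (p + q)"
  by (rule homogeneousI) (use keys_add[of p q] homogeneousD in blast)

lemma homogeneous_sum:
  "(\<And>i. i \<in> A \<Longrightarrow> homogeneous n d (f i)) \<Longrightarrow> homogeneous n d (sum f A)"
  by (induction A rule: infinite_finite_induct) (simp_all add: homogeneous_add)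

lemma homogeneous_mult:
  assumes "homogeneous n d p" "homogeneous n d' q"
  shows "homogeneous n (d + d') (p * q)"
proof (rule homogeneousI)
  fix m assume "m \<in> Poly_Mapping.keys (p * q)"
  then obtain a b where "a \<in> Poly_Mapping.keys p" "b \<in> Poly_Mapping.keys q" "m = a + b"
    using keys_mult[of p q] by blast
  then show "mdeg m = d + d' \<and> Poly_Mapping.keys m \<subseteq> {..n}"
    using homogeneousD[OF assms(1)] homogeneousD[OF assms(2)] by (simp add: mdeg_add keys_add_nat)
qed

lemma homogeneous_const_mult: "homogeneous n d p \<Longrightarrow> homogeneous n d (const c * p)"
  using homogeneous_mult[OF homogeneous_const] by fastforce

lemma homogeneous_power: "homogeneous n d p \<Longrightarrow> homogeneous n (d * k) (p ^ k)"
  by (induction k) (simp_all add: homogeneous_mult)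

lemma homogeneous_prod:
  assumes "\<And>i. i \<in> A \<Longrightarrow> homogeneous n (d i) (f i)"
  shows "homogeneous n (sum d A) (prod f A)"
  using assms by (induction A rule: infinite_finite_induct) (simp_all add: homogeneous_mult)

lemma homogeneous_mon:
  assumes "Poly_Mapping.keys m \<subseteq> {..l}" "\<And>i. i \<le> l \<Longrightarrow> homogeneous n d (G i)"
  shows "homogeneous n (d * mdeg m) (eval_mon G m)"
  unfolding eval_mon_def mdeg_def sum_distrib_left
  by (rule homogeneous_prod) (use assms in \<open>auto intro!: homogeneous_power\<close>)

lemma homogeneous_subst_poly:
  assumes "homogeneous l e p" "\<And>i. i \<le> l \<Longrightarrow> homogeneous n d (G i)"
  shows "homogeneous n (d * e) (subst_poly G p)"
  unfolding subst_poly_mon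
proof (intro homogeneous_sum homogeneous_const_mult)
  fix m assume "m \<in> Poly_Mapping.keys p"
  then show "homogeneous n (d * e) (eval_mon G m)"
    using homogeneous_mon[of m l n d G] homogeneousD[OF assms(1)] assms(2) by auto
qed

text \<open>Both sides are the value of \<open>p\<close> at the common tuple
  \<open>a * G i = b * H i\<close>. This moves identities between proportional representatives of
  one rational map without using fractions.\<close>

lemma subst_poly_scale:
  assumes "homogeneous n d p" and GH: "\<And>i. i \<le> n \<Longrightarrow> a * G i = b * H i"
  shows "a ^ d * subst_poly G p = b ^ d * subst_poly H p"
proof -
  have *: "a ^ mdeg m * eval_mon G m = eval_mon (\<lambda>i. a * G i) m" for a G m
    by (simp add: eval_mon_def mdeg_def power_mult_distrib prod.distrib power_sum)
  have "a ^ d * eval_mon G m = b ^ d * eval_mon H m" if "m \<in> Poly_Mapping.keys p" for m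
  proof -
    have "eval_mon (\<lambda>i. a * G i) m = eval_mon (\<lambda>i. b * H i) m"
      unfolding eval_mon_def
      by (intro prod.cong refl arg_cong[of _ _ "\<lambda>x. x ^ _"] GH) (use homogeneousD[OF assms(1) that] in auto)
    then show ?thesis
      using homogeneousD(1)[OF assms(1) that] * by metis
  qed
  then have "a ^ d * (const (Poly_Mapping.lookup p m) * eval_mon G m) =
      b ^ d * (const (Poly_Mapping.lookup p m) * eval_mon H m)" if "m \<in> Poly_Mapping.keys p" for m
    using that by (simp add: mult.left_commute)
  then show ?thesis
    unfolding subst_poly_mon sum_distrib_left by (rule sum.cong[OF refl])
qed

lemma single_1_of_mdeg_1:
  assumes "mdeg m = 1"
  obtains i where "m = Poly_Mapping.single i 1"
proof -
  obtain i where i: "i \<in> Poly_Mapping.keys m" "Poly_Mapping.lookup m i = 1"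
      "\<And>j. j \<in> Poly_Mapping.keys m \<Longrightarrow> j \<noteq> i \<Longrightarrow> Poly_Mapping.lookup m j = 0"
    using assms unfolding mdeg_def by (subst (asm) sum_eq_1_iff) auto
  have "m = Poly_Mapping.single i 1"
    by (rule poly_mapping_eqI) (use i in \<open>auto simp: lookup_single when_def in_keys_iff\<close>)
  then show ?thesis using that by blast
qed

lemma linear_form_expand:
  assumes "linear_form n p"
  shows "p = (\<Sum>j\<le>n. const (Poly_Mapping.lookup p (Poly_Mapping.single j 1)) * Var j)"
proof -
  let ?s = "\<lambda>j::nat. Poly_Mapping.single j (1::nat)"
  have sub: "Poly_Mapping.keys p \<subseteq> ?s ` {..n}"
  proof
    fix m assume m: "m \<in> Poly_Mapping.keys p"
    then obtain j where "m = ?s j" using homogeneousD[OF assms m] single_1_of_mdeg_1 by metis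
    then show "m \<in> ?s ` {..n}" using homogeneousD[OF assms m] by auto
  qed
  have "p = subst_poly Var p" by simp
  also have "\<dots> = (\<Sum>m\<in>?s ` {..n}. const (Poly_Mapping.lookup p m) * eval_mon Var m)"
    by (rule subst_poly_superset) (use sub in auto)
  also have "\<dots> = (\<Sum>j\<le>n. const (Poly_Mapping.lookup p (?s j)) * Var j)"
    by (subst sum.reindex) (auto simp: inj_on_def o_def)
  finally show ?thesis .
qed

lemma lookup_linear_combination:
  assumes "j \<le> n"
  shows "Poly_Mapping.lookup (\<Sum>i\<le>n. const (c i) * Var i) (Poly_Mapping.single j 1) = c j"
  using assms
  by (simp add: lookup_sum const_def Var_def mult_single lookup_single when_def)

lemma linear_combination_eq_0D:
  assumes "(\<Sum>i\<le>n. const (c i) * Var i) = 0" "j \<le> n"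
  shows "c j = 0"
  using lookup_linear_combination[OF assms(2), of c] assms(1) by simp

subsection \<open>Partial derivatives\<close>

lemma pderiv_var_superset:
  assumes "finite S" "Poly_Mapping.keys p \<subseteq> S"
  shows "pderiv_var i p = (\<Sum>m\<in>S. Poly_Mapping.single (m - Poly_Mapping.single i 1)
     (of_nat (Poly_Mapping.lookup m i) * Poly_Mapping.lookup p m))"
  unfolding pderiv_var_def using assms
  by (intro sum.mono_neutral_left) (auto simp: in_keys_iff)

lemma pderiv_var_single:
  "pderiv_var i (Poly_Mapping.single m c) =
     Poly_Mapping.single (m - Poly_Mapping.single i 1) (of_nat (Poly_Mapping.lookup m i) * c)"
  by (subst pderiv_var_superset[of "{m}"]) auto

lemma pderiv_var_0 [simp]: "pderiv_var i 0 = 0"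
  by (simp add: pderiv_var_def)

lemma pderiv_var_add: "pderiv_var i (p + q) = pderiv_var i p + pderiv_var i q"
proof -
  let ?S = "Poly_Mapping.keys p \<union> Poly_Mapping.keys q"
  have "pderiv_var i (p + q) = (\<Sum>m\<in>?S. Poly_Mapping.single (m - Poly_Mapping.single i 1)
     (of_nat (Poly_Mapping.lookup m i) * Poly_Mapping.lookup (p + q) m))"
    by (rule pderiv_var_superset) (use keys_add[of p q] in auto)
  also have "\<dots> = pderiv_var i p + pderiv_var i q"
    by (simp add: lookup_add distrib_left single_add sum.distrib pderiv_var_superset[of ?S])
  finally show ?thesis .
qed

lemma pderiv_var_sum: "pderiv_var i (sum f A) = (\<Sum>x\<in>A. pderiv_var i (f x))"
  by (induction A rule: infinite_finite_induct) (simp_all add: pderiv_var_add)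

lemma pderiv_var_mult_single:
  "pderiv_var i (Poly_Mapping.single m c * Poly_Mapping.single m' c') =
   Poly_Mapping.single m c * pderiv_var i (Poly_Mapping.single m' c') +
   pderiv_var i (Poly_Mapping.single m c) * Poly_Mapping.single m' (c' :: 'k::field_char_0)"
proof -
  let ?e = "Poly_Mapping.single i (1::nat)"
  \<comment> \<open>Truncated subtraction of \<open>?e\<close> commutes with addition once
    \<open>m'\<close> contains the variable \<open>i\<close>. If it does not, the coefficient in
    \<open>1\<close> or \<open>2\<close> is zero and the exponent is irrelevant.\<close>
  have *: "m + (m' - ?e) = m + m' - ?e" if "Poly_Mapping.lookup m' i \<noteq> 0" for m m' :: "nat \<Rightarrow>\<^sub>0 nat"
    by (rule poly_mapping_eqI) (use that in \<open>auto simp: lookup_add lookup_minus lookup_single when_def\<close>)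
  have 1: "Poly_Mapping.single (m + (m' - ?e)) (of_nat (Poly_Mapping.lookup m' i) * c * c')
      = Poly_Mapping.single (m + m' - ?e) (of_nat (Poly_Mapping.lookup m' i) * c * c')"
    using *[of m' m] by (cases "Poly_Mapping.lookup m' i = 0") auto
  have 2: "Poly_Mapping.single (m - ?e + m') (of_nat (Poly_Mapping.lookup m i) * c * c')
      = Poly_Mapping.single (m + m' - ?e) (of_nat (Poly_Mapping.lookup m i) * c * c')"
    using *[of m m'] by (cases "Poly_Mapping.lookup m i = 0") (auto simp: add.commute)
  show ?thesis
    using 1 2
    by (simp add: mult_single pderiv_var_single lookup_add algebra_simps flip: single_add)
qed

lemma pderiv_var_mult: "pderiv_var i (p * q) = p * pderiv_var i q + pderiv_var i p * q"
proof -
  let ?s = "\<lambda>p m. Poly_Mapping.single m (Poly_Mapping.lookup p m)"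
  let ?P = "Poly_Mapping.keys p" and ?Q = "Poly_Mapping.keys q"
  have "pderiv_var i ((\<Sum>m\<in>?P. ?s p m) * (\<Sum>m\<in>?Q. ?s q m)) =
      (\<Sum>m\<in>?P. ?s p m) * pderiv_var i (\<Sum>m\<in>?Q. ?s q m)
      + pderiv_var i (\<Sum>m\<in>?P. ?s p m) * (\<Sum>m\<in>?Q. ?s q m)"
    by (simp add: pderiv_var_sum sum_product pderiv_var_mult_single sum.distrib)
  then show ?thesis by (simp flip: mpoly_sum_single)
qed

lemma pderiv_var_const [simp]: "pderiv_var i (const c) = 0"
  by (simp add: const_def pderiv_var_single)

lemma pderiv_var_1 [simp]: "pderiv_var i 1 = 0"
  using pderiv_var_const[of i 1] by simp

lemma pderiv_var_Var: "pderiv_var i (Var j) = (if i = j then 1 else 0)"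
  by (auto simp: Var_def pderiv_var_single lookup_single when_def)

lemma pderiv_var_power:
  "pderiv_var i (p ^ k) = of_nat k * p ^ (k - 1) * pderiv_var i p"
proof (induction k)
  case (Suc k)
  then show ?case by (cases k) (simp_all add: pderiv_var_mult algebra_simps)
qed simp

lemma pderiv_var_prod:
  assumes "finite A"
  shows "pderiv_var i (prod f A) = (\<Sum>x\<in>A. pderiv_var i (f x) * prod f (A - {x}))"
  using assms
proof (induction A rule: finite_induct)
  case (insert a A)
  have "prod f (insert a A - {x}) = f a * prod f (A - {x})" if "x \<in> A" for x
    using insert that by (subst insert_Diff_if) auto
  moreover have "insert a A - {a} = A" using insert by auto
  ultimately show ?case
    using insert by (simp add: pderiv_var_mult sum_distrib_left mult_ac)
qed simp

lemma pderiv_var_linear_form: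
  assumes "j \<le> n"
  shows "pderiv_var j (\<Sum>i\<le>n. const (c i) * Var i) = const (c j)"
proof -
  have "pderiv_var j (\<Sum>i\<le>n. const (c i) * Var i) = (\<Sum>i\<le>n. if j = i then const (c i) else 0)"
    unfolding pderiv_var_sum by (intro sum.cong) (simp_all add: pderiv_var_mult pderiv_var_Var)
  then show ?thesis using assms by simp
qed

subsection \<open>Leading monomials\<close>

text \<open>The maximum is taken in the linear order on finitely supported functions, which is
  compatible with addition. On the zero polynomial the value is unspecified.\<close>

definition lead_mon :: "'k::field_char_0 mpoly \<Rightarrow> nat \<Rightarrow>\<^sub>0 nat" where
  "lead_mon p = Max (Poly_Mapping.keys p)"

lemma lead_mon_in_keys: "p \<noteq> 0 \<Longrightarrow> lead_mon p \<in> Poly_Mapping.keys p"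
  unfolding lead_mon_def by (intro Max_in) (auto simp: poly_mapping_eq_iff in_keys_iff fun_eq_iff)

lemma le_lead_mon: "m \<in> Poly_Mapping.keys p \<Longrightarrow> m \<le> lead_mon p"
  by (simp add: lead_mon_def)

lemma lead_mon_eqI:
  assumes "m \<in> Poly_Mapping.keys p" "\<And>m'. m' \<in> Poly_Mapping.keys p \<Longrightarrow> m' \<le> m"
  shows "lead_mon p = m"
  unfolding lead_mon_def using assms by (intro Max_eqI) auto

text \<open>The order is strictly compatible with addition, so only the pair of leading monomials
  has the sum \<open>lead_mon p + lead_mon q\<close>. No cancellation can occur in this
  coefficient.\<close>

lemma lookup_mult_lead_mon:
  assumes "p \<noteq> 0" "q \<noteq> 0"
  shows "Poly_Mapping.lookup (p * q) (lead_mon p + lead_mon q) =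
    Poly_Mapping.lookup p (lead_mon p) * Poly_Mapping.lookup q (lead_mon q)"
proof -
  let ?s = "\<lambda>p m. Poly_Mapping.single m (Poly_Mapping.lookup p m)"
  let ?P = "Poly_Mapping.keys p" and ?Q = "Poly_Mapping.keys q"
  have eq: "m = lead_mon p \<and> m' = lead_mon q"
    if "m \<in> ?P" "m' \<in> ?Q" "m + m' = lead_mon p + lead_mon q" for m m'
  proof -
    have "m \<le> lead_mon p" "m' \<le> lead_mon q"
      using le_lead_mon that by auto
    then show ?thesis
      using that(3) by (metis add_less_le_mono add_le_less_mono order_le_less less_irrefl)
  qed
  have "p * q = (\<Sum>m\<in>?P. \<Sum>m'\<in>?Q. ?s p m * ?s q m')"
    by (subst mpoly_sum_single[of p], subst mpoly_sum_single[of q]) (simp add: sum_product)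
  then have "Poly_Mapping.lookup (p * q) (lead_mon p + lead_mon q) =
      (\<Sum>m\<in>?P. \<Sum>m'\<in>?Q. if m + m' = lead_mon p + lead_mon q
         then Poly_Mapping.lookup p m * Poly_Mapping.lookup q m' else 0)"
    by (simp add: lookup_sum mult_single lookup_single when_def)
  also have "\<dots> = (\<Sum>m\<in>?P. \<Sum>m'\<in>?Q. if m = lead_mon p then if m' = lead_mon q
         then Poly_Mapping.lookup p m * Poly_Mapping.lookup q m' else 0 else 0)"
    by (intro sum.cong refl) (use eq in auto)
  also have "\<dots> = (\<Sum>m\<in>?P. if m = lead_mon p then
      Poly_Mapping.lookup p m * Poly_Mapping.lookup q (lead_mon q) else 0)"
    by (intro sum.cong refl) (simp add: lead_mon_in_keys[OF assms(2)])
  also have "\<dots> = Poly_Mapping.lookup p (lead_mon p) * Poly_Mapping.lookup q (lead_mon q)"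
    by (simp add: lead_mon_in_keys[OF assms(1)])
  finally show ?thesis .
qed

lemma lead_mon_mult:
  assumes "p \<noteq> 0" "q \<noteq> 0"
  shows "lead_mon (p * q) = lead_mon p + lead_mon q"
proof (rule lead_mon_eqI)
  show "lead_mon p + lead_mon q \<in> Poly_Mapping.keys (p * q)"
    using lookup_mult_lead_mon[OF assms] lead_mon_in_keys[OF assms(1)] lead_mon_in_keys[OF assms(2)]
    by (simp add: in_keys_iff)
next
  fix m' assume "m' \<in> Poly_Mapping.keys (p * q)"
  then obtain a b where "a \<in> Poly_Mapping.keys p" "b \<in> Poly_Mapping.keys q" "m' = a + b"
    using keys_mult[of p q] by blast
  then show "m' \<le> lead_mon p + lead_mon q"
    by (simp add: add_mono le_lead_mon)
qed

lemma lookup_lead_mon_power: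
  assumes "p \<noteq> 0"
  shows "Poly_Mapping.lookup (lead_mon (p ^ m)) i = m * Poly_Mapping.lookup (lead_mon p) i"
proof (induction m)
  case 0
  have "lead_mon (1 :: 'a mpoly) = 0" by (simp add: lead_mon_def)
  then show ?case by simp
next
  case (Suc m)
  then show ?case using assms by (simp add: lead_mon_mult lookup_add)
qed

text \<open>
  The hypothesis says that the fraction \<open>P / Q\<close> is almost integral over the polynomial ring.
  Hence the quotient of the leading terms of \<open>P\<close> and \<open>Q\<close> is a polynomial, and subtracting it from
  \<open>P / Q\<close> leaves an almost integral fraction with a smaller leading term.
\<close>

lemma almost_integral_linear:
  assumes "homogeneous n h Q" "Q \<noteq> 0" "C \<noteq> 0" "homogeneous n (Suc h) P"
    and "\<And>m. Q ^ m dvd C * P ^ m"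
  shows "\<exists>c. P = (\<Sum>j\<le>n. const (c j) * Var j) * Q"
  using assms(4,5)
proof (induction "card {j. j \<le> n \<and> Poly_Mapping.single j 1 + lead_mon Q \<le> lead_mon P}"
    arbitrary: P rule: less_induct)
  case less
  show ?case
  proof (cases "P = 0")
    case True
    then show ?thesis by (intro exI[of _ "\<lambda>_. 0"]) simp
  next
    case False
    have le: "Poly_Mapping.lookup (lead_mon Q) i \<le> Poly_Mapping.lookup (lead_mon P) i" for i
    proof (rule ccontr)
      assume gt: "\<not> ?thesis"
      \<comment> \<open>If \<open>Q\<close> had the larger exponent of the variable
        \<open>i\<close>, then comparing the leading monomials of \<open>C * P ^ m\<close> and
        \<open>Q ^ m * U\<close> would bound \<open>m\<close> by the exponent in
        \<open>lead_mon C\<close>. This \<open>m\<close> exceeds that bound by one.\<close>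
      define m where "m = Suc (Poly_Mapping.lookup (lead_mon C) i)"
      obtain U where U: "C * P ^ m = Q ^ m * U" using less.prems(2)[of m] by (elim dvdE)
      then have "U \<noteq> 0" using False assms by auto
      then have "lead_mon C + lead_mon (P ^ m) = lead_mon (Q ^ m) + lead_mon U"
        using arg_cong[OF U, of lead_mon] False assms by (simp add: lead_mon_mult)
      then have "Poly_Mapping.lookup (lead_mon C) i + m * Poly_Mapping.lookup (lead_mon P) i
          \<ge> m * Poly_Mapping.lookup (lead_mon Q) i"
        using False assms by (metis lookup_add lookup_lead_mon_power le_add1)
      moreover have "m * Poly_Mapping.lookup (lead_mon Q) i \<ge> m * Suc (Poly_Mapping.lookup (lead_mon P) i)"
        using gt by (intro mult_le_mono2) simp
      ultimately show False by (simp add: m_def)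
    qed
    define \<mu> where "\<mu> = lead_mon P - lead_mon Q"
    have \<mu>: "lead_mon P = \<mu> + lead_mon Q"
      by (rule poly_mapping_eqI) (use le in \<open>simp add: \<mu>_def lookup_add lookup_minus\<close>)
    have "mdeg \<mu> + h = Suc h"
      using homogeneousD(1)[OF assms(1) lead_mon_in_keys[OF assms(2)]]
        homogeneousD(1)[OF less.prems(1) lead_mon_in_keys[OF False]]
      by (simp add: \<mu> mdeg_add)
    then obtain j where j: "\<mu> = Poly_Mapping.single j 1"
      using single_1_of_mdeg_1[of \<mu>] by auto
    have jn: "j \<le> n"
      using homogeneousD(2)[OF less.prems(1) lead_mon_in_keys[OF False]]
      by (simp add: \<mu> j keys_add_nat)
    define a where "a = Poly_Mapping.lookup P (lead_mon P) / Poly_Mapping.lookup Q (lead_mon Q)"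
    define T where "T = const a * Var j"
    have T: "T = Poly_Mapping.single \<mu> a"
      by (simp add: T_def const_def Var_def mult_single j)
    have "a \<noteq> 0"
      using lead_mon_in_keys False assms(2) by (auto simp: a_def in_keys_iff)
    then have lT: "lead_mon T = \<mu>" "T \<noteq> 0"
      by (simp_all add: T lead_mon_def) (metis lookup_single_eq lookup_zero)
    define P' where "P' = P - T * Q"
    have hom: "homogeneous n (Suc h) P'"
    proof -
      have "homogeneous n (Suc h) (const (- a) * (Var j * Q))"
        using homogeneous_mult[OF homogeneous_Var[OF jn] assms(1)]
        by (intro homogeneous_const_mult) simp
      from homogeneous_add[OF less.prems(1) this] show ?thesis
        by (simp add: P'_def T_def const_uminus mult.assoc)
    qed
    have dvd: "Q ^ m dvd C * P' ^ m" for m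
    proof -
      \<comment> \<open>In the binomial expansion of \<open>(P - T * Q) ^ m\<close>, the power
        \<open>P ^ k\<close> together with \<open>C\<close> supplies \<open>Q ^ k\<close>, and the
        remaining power supplies \<open>Q ^ (m - k)\<close>.\<close>
      have term_dvd: "Q ^ m dvd C * (P ^ k * (- (T * Q)) ^ (m - k))" if "k \<le> m" for k
      proof -
        have "Q ^ k * Q ^ (m - k) dvd (C * P ^ k) * (- (T * Q)) ^ (m - k)"
          by (intro mult_dvd_mono less.prems(2)) (simp add: dvd_power_same)
        then show ?thesis using that by (simp add: mult.assoc flip: power_add)
      qed
      have expand: "C * P' ^ m = (\<Sum>k\<le>m. of_nat (m choose k) * (C * (P ^ k * (- (T * Q)) ^ (m - k))))"
        unfolding P'_def diff_conv_add_uminus binomial_ring sum_distrib_left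
        by (intro sum.cong refl) (simp add: mult_ac)
      show ?thesis unfolding expand by (intro dvd_sum dvd_mult term_dvd) simp
    qed
    obtain c where c: "P' = (\<Sum>j\<le>n. const (c j) * Var j) * Q"
    proof (cases "P' = 0")
      case True
      then show ?thesis by (intro that[of "\<lambda>_. 0"]) simp
    next
      case P': False
      have "lead_mon P' \<noteq> lead_mon P"
      proof
        assume "lead_mon P' = lead_mon P"
        moreover have "Poly_Mapping.lookup P' (lead_mon P) = 0"
        proof -
          have "Poly_Mapping.lookup T \<mu> = a" by (simp add: T)
          then have "Poly_Mapping.lookup (T * Q) (lead_mon P) = a * Poly_Mapping.lookup Q (lead_mon Q)"
            using lookup_mult_lead_mon[OF lT(2) assms(2)] unfolding lT(1) \<mu> by simp
          then show ?thesis
            using lead_mon_in_keys[OF assms(2)] by (simp add: P'_def lookup_minus a_def in_keys_iff)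
        qed
        ultimately show False using lead_mon_in_keys[OF P'] by (simp add: in_keys_iff)
      qed
      moreover have "m \<le> lead_mon P" if "m \<in> Poly_Mapping.keys P'" for m
      proof -
        have "m \<in> Poly_Mapping.keys P \<or> m \<in> Poly_Mapping.keys (T * Q)"
          using that by (auto simp: P'_def in_keys_iff lookup_minus)
        then show ?thesis
          using le_lead_mon[of m P] le_lead_mon[of m "T * Q"] assms(2)
          by (auto simp: lead_mon_mult lT \<mu>)
      qed
      ultimately have lt: "lead_mon P' < lead_mon P"
        using lead_mon_in_keys[OF P'] by force
      \<comment> \<open>The variable \<open>j\<close> is counted for \<open>P\<close> with equality,
        so the smaller leading monomial of \<open>P'\<close> drops it from the count.\<close>
      then have "j \<notin> {j. j \<le> n \<and> Poly_Mapping.single j 1 + lead_mon Q \<le> lead_mon P'}"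
        unfolding \<mu> j by (simp add: not_le)
      moreover have "j \<in> {j. j \<le> n \<and> Poly_Mapping.single j 1 + lead_mon Q \<le> lead_mon P}"
        using jn unfolding \<mu> j by simp
      moreover have "{j. j \<le> n \<and> Poly_Mapping.single j 1 + lead_mon Q \<le> lead_mon P'}
          \<subseteq> {j. j \<le> n \<and> Poly_Mapping.single j 1 + lead_mon Q \<le> lead_mon P}"
        using lt by (intro subsetI) (simp, metis order.trans less_imp_le)
      ultimately have "{j. j \<le> n \<and> Poly_Mapping.single j 1 + lead_mon Q \<le> lead_mon P'}
          \<subset> {j. j \<le> n \<and> Poly_Mapping.single j 1 + lead_mon Q \<le> lead_mon P}"
        by blast
      then have "card {j. j \<le> n \<and> Poly_Mapping.single j 1 + lead_mon Q \<le> lead_mon P'}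
          < card {j. j \<le> n \<and> Poly_Mapping.single j 1 + lead_mon Q \<le> lead_mon P}"
        by (intro psubset_card_mono) auto
      from less.hyps[OF this hom dvd] show ?thesis using that by blast
    qed
    have "T = (\<Sum>i\<le>n. const (if i = j then a else 0) * Var i)"
      using jn by (simp add: T_def if_distrib[of const] if_distrib[of "\<lambda>x. x * _"] cong: if_cong)
    then have "P = (\<Sum>i\<le>n. const (c i + (if i = j then a else 0)) * Var i) * Q"
      using c unfolding P'_def by (simp add: const_add distrib_right sum.distrib algebra_simps)
    then show ?thesis by (rule exI[of _ "\<lambda>i. c i + (if i = j then a else 0)"])
  qed
qed

subsection \<open>Graded subalgebras\<close>

text \<open>The degree \<open>m\<close> part of the algebra generated by \<open>G 0\<close>, ...,
  \<open>G n\<close>. Degrees are counted in the generators, not in the variables that the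
  generators contain.\<close>

definition gr :: "nat \<Rightarrow> (nat \<Rightarrow> 'k::field_char_0 mpoly) \<Rightarrow> nat \<Rightarrow> 'k mpoly set" where
  "gr n G m = subst_poly G ` {p. homogeneous n m p}"

lemma gr_0 [simp]: "0 \<in> gr n G m"
  unfolding gr_def by (rule image_eqI[of _ _ 0]) auto

lemma gr_const [simp]: "const c \<in> gr n G 0"
  unfolding gr_def by (rule image_eqI[of _ _ "const c"]) auto

lemma gr_1 [simp]: "1 \<in> gr n G 0"
  using gr_const[of 1] by simp

lemma gr_gen: "i \<le> n \<Longrightarrow> G i \<in> gr n G 1"
  unfolding gr_def by (rule image_eqI[of _ _ "Var i"]) (auto intro: homogeneous_Var[simplified])

lemma gr_add: "x \<in> gr n G m \<Longrightarrow> y \<in> gr n G m \<Longrightarrow> x + y \<in> gr n G m"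
  unfolding gr_def by (auto simp: homogeneous_add simp flip: subst_poly_add)

lemma gr_mult: "x \<in> gr n G m \<Longrightarrow> y \<in> gr n G m' \<Longrightarrow> x * y \<in> gr n G (m + m')"
  unfolding gr_def by (auto simp: homogeneous_mult simp flip: subst_poly_mult)

lemma gr_const_mult: "x \<in> gr n G m \<Longrightarrow> const c * x \<in> gr n G m"
  using gr_mult[OF gr_const] by fastforce

lemma gr_sum: "(\<And>i. i \<in> A \<Longrightarrow> f i \<in> gr n G m) \<Longrightarrow> sum f A \<in> gr n G m"
  by (induction A rule: infinite_finite_induct) (simp_all add: gr_add)

lemma gr_power: "x \<in> gr n G m \<Longrightarrow> x ^ k \<in> gr n G (m * k)"
  by (induction k) (simp_all add: gr_mult)

lemma gr_prod: "(\<And>i. i \<in> A \<Longrightarrow> f i \<in> gr n G (d i)) \<Longrightarrow> prod f A \<in> gr n G (sum d A)"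
  by (induction A rule: infinite_finite_induct) (simp_all add: gr_mult)

lemma gr_mon:
  assumes "Poly_Mapping.keys m \<subseteq> {..n}"
  shows "eval_mon G m \<in> gr n G (mdeg m)"
  unfolding eval_mon_def mdeg_def
proof (rule gr_prod)
  fix i assume "i \<in> Poly_Mapping.keys m"
  then show "G i ^ Poly_Mapping.lookup m i \<in> gr n G (Poly_Mapping.lookup m i)"
    using gr_power[OF gr_gen[of i n G], of "Poly_Mapping.lookup m i"] assms by auto
qed

subsection \<open>Dual coordinates of a finite family of vectors\<close>

text \<open>The inner sums are linear functionals of \<open>a i\<close>, one for each
  \<open>b\<close>, which act as coordinates with respect to a possibly dependent spanning family. A
  new vector \<open>a e\<close> either lies in the span of the old ones and gets the zero
  functional, or its residue \<open>res e\<close> defines a new functional.\<close>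

lemma dual_coordinates:
  fixes a :: "'b \<Rightarrow> nat \<Rightarrow> 'k::field"
  assumes "finite S"
  shows "\<exists>u. \<forall>i\<in>S. \<forall>j\<le>n. a i j = (\<Sum>b\<in>S. (\<Sum>s\<le>n. u b s * a i s) * a b j)"
  using assms
proof (induction S rule: finite_induct)
  case (insert e S)
  from insert.IH obtain u where u: "\<forall>i\<in>S. \<forall>j\<le>n. a i j = (\<Sum>b\<in>S. (\<Sum>s\<le>n. u b s * a i s) * a b j)" ..
  define D where "D = (\<lambda>b i. \<Sum>s\<le>n. u b s * a i s)"
  define res where "res = (\<lambda>i j. a i j - (\<Sum>b\<in>S. D b i * a b j))"
  have res: "res i j = 0" if "i \<in> S" "j \<le> n" for i j
    using u[rule_format, OF that] by (simp add: res_def D_def)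
  show ?case
  proof (cases "\<forall>j\<le>n. res e j = 0")
    case True
    define u' where "u' = u(e := \<lambda>_. 0)"
    have eq: "(\<Sum>b\<in>S. (\<Sum>s\<le>n. u' b s * a i s) * a b j) = (\<Sum>b\<in>S. D b i * a b j)" for i j
      using insert by (intro sum.cong) (auto simp: u'_def D_def)
    have "a i j = (\<Sum>b\<in>insert e S. (\<Sum>s\<le>n. u' b s * a i s) * a b j)" if "i \<in> insert e S" "j \<le> n" for i j
      using that True res insert.hyps unfolding sum.insert[OF insert.hyps] eq
      by (auto simp: u'_def res_def)
    then show ?thesis by blast
  next
    case False
    then obtain t where t: "t \<le> n" "res e t \<noteq> 0" by blast
    \<comment> \<open>This functional reads off coordinate \<open>t\<close> of the residue, scaled
      by \<open>res e t\<close>. It is zero on the old vectors and one on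
      \<open>a e\<close>.\<close>
    define \<phi> where "\<phi> = (\<lambda>s. ((if s = t then 1 else 0) - (\<Sum>b\<in>S. u b s * a b t)) / res e t)"
    \<comment> \<open>The correction makes the old functionals vanish on \<open>a e\<close> and
      leaves their values on the old vectors unchanged.\<close>
    define u' where "u' = (\<lambda>b s. if b = e then \<phi> s else u b s - D b e * \<phi> s)"
    have \<phi>: "(\<Sum>s\<le>n. \<phi> s * a i s) = res i t / res e t" for i
    proof -
      have "(\<Sum>s\<le>n. \<phi> s * a i s) =
          (\<Sum>s\<le>n. ((if s = t then a i s else 0) - (\<Sum>b\<in>S. u b s * a i s * a b t)) / res e t)"
        by (intro sum.cong refl) (auto simp: \<phi>_def algebra_simps sum_distrib_left)
      also have "\<dots> = ((\<Sum>s\<le>n. if s = t then a i s else 0) - (\<Sum>s\<le>n. \<Sum>b\<in>S. u b s * a i s * a b t)) / res e t"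
        by (simp add: sum_subtractf flip: sum_divide_distrib)
      also have "\<dots> = res i t / res e t"
        using t(1) by (simp add: res_def D_def sum_distrib_right sum.swap[of _ S])
      finally show ?thesis .
    qed
    have D': "(\<Sum>s\<le>n. u' b s * a i s) = (if b = e then res i t / res e t else D b i - D b e * (res i t / res e t))"
      for b i
    proof (cases "b = e")
      case False
      then have "(\<Sum>s\<le>n. u' b s * a i s) = D b i - D b e * (\<Sum>s\<le>n. \<phi> s * a i s)"
        by (simp add: u'_def D_def left_diff_distrib sum_subtractf sum_distrib_left mult.assoc)
      then show ?thesis using False by (simp add: \<phi>)
    qed (simp add: u'_def \<phi>)
    have "a i j = (\<Sum>b\<in>insert e S. (\<Sum>s\<le>n. u' b s * a i s) * a b j)" if "i \<in> insert e S" "j \<le> n" for i j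
    proof -
      have "(\<Sum>b\<in>S. (\<Sum>s\<le>n. u' b s * a i s) * a b j) =
          (\<Sum>b\<in>S. (D b i - D b e * (res i t / res e t)) * a b j)"
        unfolding D' using insert by (intro sum.cong) auto
      also have "\<dots> = (\<Sum>b\<in>S. D b i * a b j) - res i t / res e t * (\<Sum>b\<in>S. D b e * a b j)"
        by (simp add: algebra_simps sum_subtractf sum_distrib_left)
      also have "\<dots> = (a i j - res i j) - res i t / res e t * (a e j - res e j)"
        by (simp add: res_def)
      finally have "(\<Sum>b\<in>insert e S. (\<Sum>s\<le>n. u' b s * a i s) * a b j) =
          a i j - res i j + res i t / res e t * res e j"
        unfolding sum.insert[OF insert.hyps] D' by (simp add: algebra_simps diff_divide_distrib)
      then show ?thesis using that res t by (cases "i = e") auto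
    qed
    then show ?thesis by blast
  qed
qed simp

subsection \<open>Weighted hyperplane arrangements\<close>

definition lin :: "nat \<Rightarrow> (nat \<Rightarrow> 'k::field_char_0) \<Rightarrow> 'k mpoly" where
  "lin n c = (\<Sum>j\<le>n. const (c j) * Var j)"

lemma homogeneous_lin: "homogeneous n 1 (lin n c)"
  unfolding lin_def by (intro homogeneous_sum homogeneous_const_mult homogeneous_Var) simp

lemma subst_poly_lin: "subst_poly G (lin n c) = (\<Sum>j\<le>n. const (c j) * G j)"
  by (simp add: lin_def subst_poly_hom)

lemma lin_eq_0D: "lin n c = 0 \<Longrightarrow> j \<le> n \<Longrightarrow> c j = 0"
  unfolding lin_def by (rule linear_combination_eq_0D)

text \<open>The forms are kept as coefficient arrays \<open>a\<close> and the exponents as separate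
  weights \<open>e\<close>, so that one arrangement can be interpreted with several weights.\<close>

locale arrangement =
  fixes n r :: nat and a :: "nat \<Rightarrow> nat \<Rightarrow> 'k::field_char_0" and e :: "nat \<Rightarrow> nat"
  assumes e_pos: "i \<le> r \<Longrightarrow> e i \<ge> 1"
    and lin_nonzero: "i \<le> r \<Longrightarrow> lin n (a i) \<noteq> 0"
    and not_proportional: "i \<le> r \<Longrightarrow> j \<le> r \<Longrightarrow> i \<noteq> j \<Longrightarrow> lin n (a i) \<noteq> const c * lin n (a j)"
begin

definition L where "L i = lin n (a i)"
definition w where "w i = (\<Prod>k\<in>{..r} - {i}. L k)"
definition W where "W = (\<Prod>k\<le>r. L k)"
definition N where "N j = (\<Sum>i\<le>r. const (of_nat (e i) * a i j) * w i)"
definition wt :: nat where "wt = (\<Sum>i\<le>r. e i)"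

lemma homogeneous_L: "homogeneous n 1 (L i)"
  unfolding L_def by (rule homogeneous_lin)

lemma L_nonzero: "i \<le> r \<Longrightarrow> L i \<noteq> 0"
  unfolding L_def by (rule lin_nonzero)

lemma w_L: "i \<le> r \<Longrightarrow> w i * L i = W"
  unfolding w_def W_def by (subst prod.remove[of _ i]) (auto simp: mult.commute)

lemma W_nonzero: "W \<noteq> 0"
  unfolding W_def by (simp add: L_nonzero)

lemma wt_nonzero: "(of_nat wt :: 'k) \<noteq> 0"
proof -
  have "wt \<noteq> 0" using e_pos[of 0] by (auto simp: wt_def Suc_le_eq intro!: bexI[of _ 0])
  then show ?thesis by simp
qed

lemma homogeneous_w:
  assumes "i \<le> r"
  shows "homogeneous n r (w i)"
proof -
  have "homogeneous n (\<Sum>k\<in>{..r} - {i}. 1) (w i)"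
    unfolding w_def by (intro homogeneous_prod homogeneous_L)
  then show ?thesis using assms by simp
qed

lemma homogeneous_N: "homogeneous n r (N j)"
  unfolding N_def by (intro homogeneous_sum homogeneous_const_mult homogeneous_w) simp

text \<open>Euler's formula for the weighted product of the forms, after division by the factor
  common to all partial derivatives. It exhibits \<open>W\<close>, and with it the fractions
  \<open>w i = W / L i\<close>, in terms of \<open>N\<close>.\<close>

lemma euler_N: "(\<Sum>j\<le>n. Var j * N j) = const (of_nat wt) * W"
proof -
  have "(\<Sum>j\<le>n. Var j * N j) = (\<Sum>i\<le>r. \<Sum>j\<le>n. const (of_nat (e i)) * (w i * (const (a i j) * Var j)))"
    unfolding N_def sum_distrib_left
    by (subst sum.swap) (intro sum.cong refl, simp add: const_mult mult_ac)
  also have "\<dots> = (\<Sum>i\<le>r. const (of_nat (e i)) * W)"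
    by (intro sum.cong refl) (simp add: w_L[symmetric] L_def lin_def sum_distrib_left)
  finally show ?thesis by (simp add: wt_def const_sum sum_distrib_right)
qed

text \<open>The substitution \<open>\<sigma>\<close> projects onto the hyperplane \<open>L i = 0\<close>, along a coordinate axis.\<close>

lemma hyperplane_substitution:
  assumes i: "i \<le> r"
  obtains \<sigma> where "subst_poly \<sigma> (L i) = 0" "\<And>k. k \<le> r \<Longrightarrow> k \<noteq> i \<Longrightarrow> subst_poly \<sigma> (L k) \<noteq> 0"
    "\<And>j. L i dvd \<sigma> j - Var j"
proof -
  obtain s where s: "s \<le> n" "a i s \<noteq> 0"
    using L_nonzero[OF i] unfolding L_def lin_def by (metis (mono_tags) atMost_iff const_0 mult_zero_left sum.neutral)
  define \<sigma> where "\<sigma> = (\<lambda>j. Var j - (if j = s then const (1 / a i s) * L i else 0))"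
  have \<sigma>: "subst_poly \<sigma> (L k) = L k - const (a k s / a i s) * L i" for k
  proof -
    have "subst_poly \<sigma> (L k) =
        (\<Sum>j\<le>n. const (a k j) * Var j - (if j = s then const (a k s) * (const (1 / a i s) * L i) else 0))"
      unfolding L_def subst_poly_lin by (intro sum.cong) (auto simp: \<sigma>_def L_def right_diff_distrib)
    also have "\<dots> = L k - const (a k s) * (const (1 / a i s) * L i)"
      using s(1) by (simp add: sum_subtractf L_def lin_def)
    also have "const (a k s) * (const (1 / a i s) * L i) = const (a k s / a i s) * L i"
      by (simp flip: const_mult mult.assoc)
    finally show ?thesis .
  qed
  show ?thesis
  proof (rule that[of \<sigma>])
    show "subst_poly \<sigma> (L i) = 0" using s by (simp add: \<sigma>)
    show "subst_poly \<sigma> (L k) \<noteq> 0" if "k \<le> r" "k \<noteq> i" for k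
      using not_proportional[OF that(1) i that(2), of "a k s / a i s"] unfolding \<sigma> by (auto simp: L_def)
    show "L i dvd \<sigma> j - Var j" for j by (simp add: \<sigma>_def)
  qed
qed

text \<open>On the hyperplane \<open>L i = 0\<close> every \<open>w l\<close> with
  \<open>l \<noteq> i\<close> vanishes, because it contains the factor \<open>L i\<close>, whereas
  \<open>w i\<close> does not vanish there.\<close>

lemma w_independent:
  assumes "(\<Sum>l\<le>r. const (c l) * w l) = 0" and i: "i \<le> r"
  shows "c i = 0"
proof -
  obtain \<sigma> where \<sigma>: "subst_poly \<sigma> (L i) = 0" "\<And>k. k \<le> r \<Longrightarrow> k \<noteq> i \<Longrightarrow> subst_poly \<sigma> (L k) \<noteq> 0"
    using hyperplane_substitution[OF i] by blast
  have "subst_poly \<sigma> (w l) = 0" if "l \<le> r" "l \<noteq> i" for l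
    unfolding w_def subst_poly_prod using that i \<sigma>(1) by (intro prod_zero) auto
  then have "(\<Sum>l\<le>r. const (c l) * subst_poly \<sigma> (w l)) = (\<Sum>l\<le>r. if l = i then const (c i) * subst_poly \<sigma> (w i) else 0)"
    by (intro sum.cong) auto
  then have "const (c i) * subst_poly \<sigma> (w i) = 0"
    using arg_cong[OF assms(1), of "subst_poly \<sigma>"] i by (simp add: subst_poly_hom)
  moreover have "subst_poly \<sigma> (w i) \<noteq> 0"
    unfolding w_def subst_poly_prod using \<sigma>(2) by simp
  ultimately show ?thesis by simp
qed

section \<open>Products of the \<open>w i\<close> and their nilpotency modulo the
  \<open>N j\<close>\<close>

definition wprod where "wprod S = (\<Prod>i\<in>S. w i)"

lemma wprod_gr: "S \<subseteq> {..r} \<Longrightarrow> wprod S \<in> gr r w (card S)"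
  using gr_prod[of S w r w "\<lambda>_. 1"] gr_gen[of _ r w] by (auto simp: wprod_def)

lemma wprod_insert: "finite S \<Longrightarrow> i \<notin> S \<Longrightarrow> wprod (insert i S) = w i * wprod S"
  by (simp add: wprod_def)

text \<open>
  This is \<open>\<Sum>\<^sub>i\<^sub>\<in>\<^sub>S e\<^sub>i w\<^sub>i L\<^sub>i = (\<Sum>\<^sub>i\<^sub>\<in>\<^sub>S e\<^sub>i) W\<close> after expanding the \<open>L\<^sub>i\<close> with \<open>i \<in> S\<close> in dual coordinates.
\<close>

lemma wprod_relation:
  assumes S: "S \<subseteq> {..r}"
  obtains u where
    "const (of_nat (\<Sum>i\<in>S. e i)) * wprod S = (\<Sum>b\<in>S. wprod (S - {b}) *
      ((\<Sum>j\<le>n. const (u b j) * N j) -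
       (\<Sum>i\<in>{..r} - S. const (of_nat (e i) * (\<Sum>j\<le>n. u b j * a i j)) * w i)))"
proof -
  have fin: "finite S" using S finite_subset by blast
  obtain u where u: "\<forall>i\<in>S. \<forall>j\<le>n. a i j = (\<Sum>b\<in>S. (\<Sum>s\<le>n. u b s * a i s) * a b j)"
    using dual_coordinates[OF fin, of n a] ..
  define D where "D = (\<lambda>b i. \<Sum>j\<le>n. u b j * a i j)"
  have L: "L i = (\<Sum>b\<in>S. const (D b i) * L b)" if "i \<in> S" for i
  proof -
    have "L i = (\<Sum>j\<le>n. \<Sum>b\<in>S. const (D b i) * (const (a b j) * Var j))"
      unfolding L_def lin_def
    proof (intro sum.cong refl)
      fix j assume j: "j \<in> {..n}"
      have "a i j = (\<Sum>b\<in>S. D b i * a b j)"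
        unfolding D_def using j by (intro u[rule_format, OF that]) simp
      then have "const (a i j) * Var j = const (\<Sum>b\<in>S. D b i * a b j) * Var j" by simp
      then show "const (a i j) * Var j = (\<Sum>b\<in>S. const (D b i) * (const (a b j) * Var j))"
        by (simp add: const_sum const_mult sum_distrib_right mult.assoc)
    qed
    then show ?thesis
      by (subst (asm) sum.swap) (simp add: L_def lin_def sum_distrib_left)
  qed
  have inner: "(\<Sum>j\<le>n. const (u b j) * N j) - (\<Sum>i\<in>{..r} - S. const (of_nat (e i) * D b i) * w i)
      = (\<Sum>i\<in>S. const (of_nat (e i) * D b i) * w i)" for b
  proof -
    have "(\<Sum>j\<le>n. const (u b j) * N j) = (\<Sum>i\<le>r. \<Sum>j\<le>n. const (of_nat (e i)) * (const (u b j * a i j) * w i))"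
      unfolding N_def sum_distrib_left
      by (subst sum.swap) (intro sum.cong refl, simp add: const_mult mult_ac)
    also have "\<dots> = (\<Sum>i\<le>r. const (of_nat (e i) * D b i) * w i)"
      by (intro sum.cong refl)
        (simp add: D_def const_mult const_sum sum_distrib_left sum_distrib_right mult_ac)
    also have "\<dots> = (\<Sum>i\<in>{..r} - S. const (of_nat (e i) * D b i) * w i)
        + (\<Sum>i\<in>S. const (of_nat (e i) * D b i) * w i)"
      using S by (intro sum.subset_diff) auto
    finally show ?thesis by simp
  qed
  have W: "W * wprod (S - {b}) = L b * wprod S" if "b \<in> S" for b
  proof -
    have "wprod S = w b * wprod (S - {b})"
      unfolding wprod_def using fin that by (rule prod.remove)
    moreover have "W = w b * L b" using w_L[of b] S that by auto
    ultimately show ?thesis by (simp only: mult_ac)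
  qed
  \<comment> \<open>Multiplication by \<open>W\<close> turns \<open>wprod (S - {b})\<close> into
    \<open>L b * wprod S\<close>. The sum over \<open>b\<close> then reassembles \<open>L i\<close>
    from its dual coordinates, and the factor \<open>W\<close> is cancelled at the end.\<close>
  have "W * (\<Sum>b\<in>S. wprod (S - {b}) * (\<Sum>i\<in>S. const (of_nat (e i) * D b i) * w i))
      = (\<Sum>b\<in>S. (W * wprod (S - {b})) * (\<Sum>i\<in>S. const (of_nat (e i) * D b i) * w i))"
    by (simp add: sum_distrib_left mult.assoc)
  also have "\<dots> = (\<Sum>b\<in>S. (L b * wprod S) * (\<Sum>i\<in>S. const (of_nat (e i) * D b i) * w i))"
    by (intro sum.cong refl) (simp add: W)
  also have "\<dots> = (\<Sum>i\<in>S. \<Sum>b\<in>S. wprod S * (const (of_nat (e i)) * (w i * (const (D b i) * L b))))"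
    unfolding sum_distrib_left by (subst sum.swap) (intro sum.cong refl, simp add: const_mult mult_ac)
  also have "\<dots> = (\<Sum>i\<in>S. wprod S * (const (of_nat (e i)) * (w i * L i)))"
    by (intro sum.cong refl) (simp only: L sum_distrib_left)
  also have "\<dots> = (\<Sum>i\<in>S. wprod S * (const (of_nat (e i)) * W))"
    using S by (intro sum.cong refl) (auto simp: w_L subset_iff)
  also have "\<dots> = W * (const (of_nat (\<Sum>i\<in>S. e i)) * wprod S)"
    by (simp add: const_sum sum_distrib_right sum_distrib_left mult_ac)
  finally have "(\<Sum>b\<in>S. wprod (S - {b}) * (\<Sum>i\<in>S. const (of_nat (e i) * D b i) * w i))
      = const (of_nat (\<Sum>i\<in>S. e i)) * wprod S"
    using W_nonzero by (simp only: mult_cancel_left) simp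
  then show ?thesis using that[of u] inner unfolding D_def by simp
qed

text \<open>
  \<open>idl m\<close> is the degree \<open>m\<close> part of the ideal generated by \<open>N 0, \<dots>, N n\<close> in the graded ring
  \<open>k[w\<^sub>0, \<dots>, w\<^sub>r]\<close>, and \<open>rad\<close> is its radical.
\<close>

definition idl where
  "idl m = {x. \<exists>k \<rho>. m = Suc k \<and> (\<forall>j\<le>n. \<rho> j \<in> gr r w k) \<and> x = (\<Sum>j\<le>n. N j * \<rho> j)}"

definition rad where
  "rad d = {x \<in> gr r w d. \<exists>K. x ^ K \<in> idl (d * K)}"

lemma N_gr: "N j \<in> gr r w 1"
  unfolding N_def by (intro gr_sum gr_const_mult gr_gen) simp

lemma idl_gr: "x \<in> idl m \<Longrightarrow> x \<in> gr r w m"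
  unfolding idl_def using gr_mult[OF N_gr] by (force intro!: gr_sum)

lemma idl_pos: "x \<in> idl m \<Longrightarrow> m \<ge> 1"
  by (auto simp: idl_def)

lemma idl_0: "m \<ge> 1 \<Longrightarrow> 0 \<in> idl m"
  unfolding idl_def by (auto intro!: exI[of _ "m - 1"] exI[of _ "\<lambda>_. 0"])

lemma idl_add:
  assumes "x \<in> idl m" "y \<in> idl m"
  shows "x + y \<in> idl m"
proof -
  obtain k \<rho> \<rho>' where "m = Suc k" "\<forall>j\<le>n. \<rho> j \<in> gr r w k" "x = (\<Sum>j\<le>n. N j * \<rho> j)"
      "\<forall>j\<le>n. \<rho>' j \<in> gr r w k" "y = (\<Sum>j\<le>n. N j * \<rho>' j)"
    using assms unfolding idl_def by auto
  then show ?thesis unfolding idl_def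
    by (auto intro!: exI[of _ k] exI[of _ "\<lambda>j. \<rho> j + \<rho>' j"] gr_add simp: distrib_left sum.distrib)
qed

lemma idl_mult:
  assumes "x \<in> idl m" "y \<in> gr r w d"
  shows "x * y \<in> idl (m + d)"
proof -
  obtain k \<rho> where "m = Suc k" "\<forall>j\<le>n. \<rho> j \<in> gr r w k" "x = (\<Sum>j\<le>n. N j * \<rho> j)"
    using assms(1) unfolding idl_def by auto
  then show ?thesis unfolding idl_def using assms(2)
    by (auto intro!: exI[of _ "k + d"] exI[of _ "\<lambda>j. \<rho> j * y"] gr_mult simp: sum_distrib_right mult.assoc)
qed

lemma idl_sum: "m \<ge> 1 \<Longrightarrow> (\<And>i. i \<in> A \<Longrightarrow> f i \<in> idl m) \<Longrightarrow> sum f A \<in> idl m"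
  by (induction A rule: infinite_finite_induct) (simp_all add: idl_0 idl_add)

lemma rad_gr: "x \<in> rad d \<Longrightarrow> x \<in> gr r w d"
  by (simp add: rad_def)

lemma idl_rad: "x \<in> idl d \<Longrightarrow> x \<in> rad d"
  unfolding rad_def by (auto intro!: exI[of _ 1] idl_gr)

lemma rad_0: "d \<ge> 1 \<Longrightarrow> 0 \<in> rad d"
  by (intro idl_rad idl_0)

text \<open>Every term of the binomial expansion of \<open>(x + y) ^ (K + J)\<close> contains
  \<open>x ^ K\<close> or \<open>y ^ J\<close>.\<close>

lemma rad_add:
  assumes "x \<in> rad d" "y \<in> rad d"
  shows "x + y \<in> rad d"
proof -
  obtain K J where K: "x ^ K \<in> idl (d * K)" and J: "y ^ J \<in> idl (d * J)"
    using assms by (auto simp: rad_def)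
  note [simp] = rad_gr[OF assms(1)] rad_gr[OF assms(2)]
  have "of_nat ((K + J) choose k) * x ^ k * y ^ (K + J - k) \<in> idl (d * (K + J))" if "k \<le> K + J" for k
  proof (cases "k \<ge> K")
    case True
    have "x ^ K * (const (of_nat ((K + J) choose k)) * (x ^ (k - K) * y ^ (K + J - k)))
        \<in> idl (d * K + (d * (k - K) + d * (K + J - k)))"
      by (intro idl_mult K gr_const_mult gr_mult gr_power) simp_all
    moreover have "d * K + (d * (k - K) + d * (K + J - k)) = d * (K + J)"
      using True that by (simp flip: distrib_left)
    moreover have "x ^ K * x ^ (k - K) = x ^ k" using True by (simp flip: power_add)
    ultimately show ?thesis by (simp add: mult_ac) (metis (no_types, opaque_lifting) mult.commute mult.left_commute)
  next
    case False
    have "y ^ J * (const (of_nat ((K + J) choose k)) * (y ^ (K - k) * x ^ k))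
        \<in> idl (d * J + (d * (K - k) + d * k))"
      by (intro idl_mult J gr_const_mult gr_mult gr_power) simp_all
    moreover have "d * J + (d * (K - k) + d * k) = d * (K + J)"
      using False by (simp flip: distrib_left)
    moreover have "y ^ J * y ^ (K - k) = y ^ (K + J - k)" using False by (simp add: add.commute flip: power_add)
    ultimately show ?thesis by (simp add: mult_ac) (metis (no_types, opaque_lifting) mult.commute mult.left_commute)
  qed
  then have "(x + y) ^ (K + J) \<in> idl (d * (K + J))"
    unfolding binomial_ring using idl_pos[OF K] by (intro idl_sum) auto
  then show ?thesis by (auto simp: rad_def intro: gr_add)
qed

lemma rad_sum: "d \<ge> 1 \<Longrightarrow> (\<And>i. i \<in> A \<Longrightarrow> f i \<in> rad d) \<Longrightarrow> sum f A \<in> rad d"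
  by (induction A rule: infinite_finite_induct) (simp_all add: rad_0 rad_add)

lemma rad_mult:
  assumes "x \<in> rad d" "y \<in> gr r w d'"
  shows "x * y \<in> rad (d + d')"
proof -
  obtain K where "x ^ K \<in> idl (d * K)" using assms(1) by (auto simp: rad_def)
  from idl_mult[OF this gr_power[OF assms(2)], of K] gr_mult[OF rad_gr[OF assms(1)] assms(2)]
  show ?thesis by (auto simp: rad_def power_mult_distrib distrib_right)
qed

lemma rad_const_mult: "x \<in> rad d \<Longrightarrow> const c * x \<in> rad d"
  using rad_mult[OF _ gr_const] by (fastforce simp: mult.commute)

lemma rad_power_D:
  assumes "x ^ k \<in> rad (d * k)" "x \<in> gr r w d"
  shows "x \<in> rad d"
  using assms by (auto simp: rad_def mult.assoc simp flip: power_mult)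

text \<open>
  Modulo the \<open>N\<^sub>j\<close>, \<open>wprod_relation\<close> expresses the square of \<open>wprod S\<close> by multiples of the
  \<open>wprod (S \<union> {i})\<close> with \<open>i \<notin> S\<close>.
\<close>

lemma wprod_rad: "S \<subseteq> {..r} \<Longrightarrow> S \<noteq> {} \<Longrightarrow> wprod S \<in> rad (card S)"
proof (induction "card ({..r} - S)" arbitrary: S rule: less_induct)
  case less
  note S = less.prems
  have fin: "finite S" using S finite_subset by blast
  then have pos: "card S \<ge> 1" using S by (simp add: Suc_le_eq card_gt_0_iff)
  define s where "s = (\<Sum>i\<in>S. e i)"
  \<comment> \<open>Positivity of the weights enters here. In characteristic zero \<open>s\<close>
    is then invertible in the field, so the relation can be solved for
    \<open>wprod S\<close>.\<close>
  have "s \<noteq> 0" using S fin e_pos by (fastforce simp: s_def)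
  obtain u where u: "const (of_nat s) * wprod S = (\<Sum>b\<in>S. wprod (S - {b}) *
      ((\<Sum>j\<le>n. const (u b j) * N j) -
       (\<Sum>i\<in>{..r} - S. const (of_nat (e i) * (\<Sum>j\<le>n. u b j * a i j)) * w i)))"
    unfolding s_def using wprod_relation[OF S(1)] by blast
  have "wprod S * (wprod (S - {b}) * ((\<Sum>j\<le>n. const (u b j) * N j) -
       (\<Sum>i\<in>{..r} - S. const (of_nat (e i) * (\<Sum>j\<le>n. u b j * a i j)) * w i))) \<in> rad (card S * 2)"
    if b: "b \<in> S" for b
  proof -
    have 1: "wprod (S - {b}) \<in> gr r w (card S - 1)"
      using wprod_gr[of "S - {b}"] S b fin by auto
    have "(\<Sum>j\<le>n. N j * const (u b j)) \<in> idl 1"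
      unfolding idl_def by (auto intro!: exI[of _ "\<lambda>j. const (u b j)"])
    from rad_mult[OF idl_rad[OF this] gr_mult[OF wprod_gr[OF S(1)] 1]]
    have A: "(\<Sum>j\<le>n. N j * const (u b j)) * (wprod S * wprod (S - {b})) \<in> rad (card S * 2)"
      using pos by (simp add: algebra_simps mult_2_right)
    \<comment> \<open>The product \<open>w i * wprod S\<close> with \<open>i\<close> outside
      \<open>S\<close> is \<open>wprod (insert i S)\<close>, to which the induction hypothesis for
      the larger set applies.\<close>
    have B: "const c * (wprod (insert i S) * wprod (S - {b})) \<in> rad (card S * 2)"
      if i: "i \<in> {..r} - S" for i c
    proof -
      have "card ({..r} - insert i S) < card ({..r} - S)"
        using i by (intro psubset_card_mono) auto
      then have "wprod (insert i S) \<in> rad (card (insert i S))"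
        using less.hyps[of "insert i S"] S i by auto
      from rad_const_mult[OF rad_mult[OF this 1]] show ?thesis
        using i fin pos by (simp add: mult_2_right)
    qed
    have "(\<Sum>i\<in>{..r} - S. const (- (of_nat (e i) * (\<Sum>j\<le>n. u b j * a i j))) *
        (wprod (insert i S) * wprod (S - {b}))) \<in> rad (card S * 2)"
      using pos by (intro rad_sum B) auto
    from rad_add[OF A this] show ?thesis
      using fin by (simp add: wprod_insert const_uminus sum_negf algebra_simps sum_distrib_left)
  qed
  then have "(\<Sum>b\<in>S. wprod S * (wprod (S - {b}) * ((\<Sum>j\<le>n. const (u b j) * N j) -
       (\<Sum>i\<in>{..r} - S. const (of_nat (e i) * (\<Sum>j\<le>n. u b j * a i j)) * w i)))) \<in> rad (card S * 2)"
    using pos by (intro rad_sum) auto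
  then have "wprod S * (const (of_nat s) * wprod S) \<in> rad (card S * 2)"
    unfolding u by (simp add: sum_distrib_left)
  from rad_const_mult[OF this, of "1 / of_nat s"]
  have "const (1 / of_nat s * of_nat s) * (wprod S * wprod S) \<in> rad (card S * 2)"
    by (simp only: const_mult mult_ac)
  then have "wprod S ^ 2 \<in> rad (card S * 2)"
    using \<open>s \<noteq> 0\<close> by (simp add: power2_eq_square)
  then show ?case using wprod_gr[OF S(1)] by (rule rad_power_D)
qed

end

section \<open>Necessity: a birational polar map forces an invertible coefficient matrix\<close>

definition inverse_arrays :: "nat \<Rightarrow> (nat \<Rightarrow> nat \<Rightarrow> 'k::field) \<Rightarrow> (nat \<Rightarrow> nat \<Rightarrow> 'k) \<Rightarrow> bool" where
  "inverse_arrays n f g \<longleftrightarrow>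
     (\<forall>i\<le>n. \<forall>l\<le>n. (\<Sum>j\<le>n. f i j * g j l) = (if i = l then 1 else 0)) \<and>
     (\<forall>i\<le>n. \<forall>l\<le>n. (\<Sum>j\<le>n. g i j * f j l) = (if i = l then 1 else 0))"

context arrangement
begin

text \<open>Singletons in \<open>wprod_rad\<close> make each \<open>w i\<close> nilpotent modulo the
  \<open>N j\<close>. By the pigeonhole principle a monomial of large degree contains one of the
  powers \<open>w i ^ K i\<close>.\<close>

lemma monomial_in_idl:
  "\<exists>D. \<forall>m. Poly_Mapping.keys m \<subseteq> {..r} \<longrightarrow> mdeg m > D \<longrightarrow> eval_mon w m \<in> idl (mdeg m)"
proof -
  have "w i \<in> rad 1" if "i \<le> r" for i
    using wprod_rad[of "{i}"] that by (simp add: wprod_def)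
  then have "\<forall>i. \<exists>k. i \<le> r \<longrightarrow> w i ^ k \<in> idl k"
    by (auto simp: rad_def)
  then obtain K where K: "\<And>i. i \<le> r \<Longrightarrow> w i ^ K i \<in> idl (K i)"
    by metis
  have "eval_mon w m \<in> idl (mdeg m)" if m: "Poly_Mapping.keys m \<subseteq> {..r}" "mdeg m > (\<Sum>i\<le>r. K i)" for m
  proof -
    have "\<exists>i\<le>r. Poly_Mapping.lookup m i \<ge> K i"
    proof (rule ccontr)
      assume "\<not> ?thesis"
      then have "(\<Sum>i\<le>r. Poly_Mapping.lookup m i) \<le> (\<Sum>i\<le>r. K i)"
        by (intro sum_mono) force
      then show False using m mdeg_superset[of "{..r}" m] by simp
    qed
    then obtain i where i: "i \<le> r" "Poly_Mapping.lookup m i \<ge> K i" by blast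
    define m' where "m' = m - Poly_Mapping.single i (K i)"
    have m': "m = Poly_Mapping.single i (K i) + m'"
      by (rule poly_mapping_eqI) (use i in \<open>auto simp: m'_def lookup_add lookup_minus lookup_single when_def\<close>)
    have "Poly_Mapping.keys m' \<subseteq> {..r}"
      using m(1) by (subst (asm) m') (simp add: keys_add_nat)
    from idl_mult[OF K[OF i(1)] gr_mon[OF this]] show ?thesis
      by (simp add: m' eval_mon_add mdeg_add)
  qed
  then show ?thesis by blast
qed

text \<open>
  \<open>k[w\<^sub>0, \<dots>, w\<^sub>r]\<close> is spanned over \<open>k[N\<^sub>0, \<dots>, N\<^sub>n]\<close> by the monomials of bounded degree, so if
  \<open>w\<^sub>i = P(N) / Q\<^sub>i(N)\<close> then a power of \<open>\<Prod>\<^sub>i Q\<^sub>i\<close> is a common denominator.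
\<close>

lemma common_denominator:
  assumes P: "homogeneous n (Suc h) P" and Q: "\<And>i. i \<le> r \<Longrightarrow> homogeneous n h (Q i)"
    and PQ: "\<And>i. i \<le> r \<Longrightarrow> subst_poly N P = w i * subst_poly N (Q i)"
  obtains D where "\<And>k x. x \<in> gr r w k \<Longrightarrow>
    subst_poly N ((\<Prod>i\<le>r. Q i) ^ D) * x \<in> gr n N ((\<Sum>i\<le>r. h * D) + k)"
proof -
  obtain D where D: "\<And>m. Poly_Mapping.keys m \<subseteq> {..r} \<Longrightarrow> mdeg m > D \<Longrightarrow> eval_mon w m \<in> idl (mdeg m)"
    using monomial_in_idl by blast
  define C where "C = subst_poly N ((\<Prod>i\<le>r. Q i) ^ D)"
  have "C * x \<in> gr n N ((\<Sum>i\<le>r. h * D) + k)" if "x \<in> gr r w k" for k x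
    using that
  proof (induction k arbitrary: x rule: less_induct)
    case (less k)
    \<comment> \<open>Above degree \<open>D\<close> the monomial lies in the ideal, and the
      induction hypothesis applies to its coefficients. Up to degree \<open>D\<close> every exponent
      is at most \<open>D\<close>, so the \<open>D\<close> copies of \<open>Q i\<close> in
      \<open>C\<close> turn each power of \<open>w i\<close> into the same power of
      \<open>P\<close>.\<close>
    have *: "C * eval_mon w m \<in> gr n N ((\<Sum>i\<le>r. h * D) + k)"
      if m: "Poly_Mapping.keys m \<subseteq> {..r}" "mdeg m = k" for m
    proof (cases "k > D")
      case True
      then obtain k' \<rho> where k': "k = Suc k'" and \<rho>: "\<And>j. j \<le> n \<Longrightarrow> \<rho> j \<in> gr r w k'"
          and eval_mon: "eval_mon w m = (\<Sum>j\<le>n. N j * \<rho> j)"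
        using D[of m] m unfolding idl_def by auto
      have "N j * (C * \<rho> j) \<in> gr n N (1 + ((\<Sum>i\<le>r. h * D) + k'))" if "j \<le> n" for j
        using gr_mult[OF gr_gen[OF that] less.IH[OF _ \<rho>[OF that]]] k' by simp
      then have "(\<Sum>j\<le>n. N j * (C * \<rho> j)) \<in> gr n N ((\<Sum>i\<le>r. h * D) + k)"
        by (intro gr_sum) (simp add: k')
      then show ?thesis by (simp add: eval_mon sum_distrib_left mult_ac)
    next
      case False
      define x where "x = (\<lambda>i. Poly_Mapping.lookup m i)"
      have sum: "(\<Sum>i\<le>r. x i) = k"
        using m mdeg_superset[of "{..r}" m] by (simp add: x_def)
      have x_le: "x i \<le> D" if "i \<le> r" for i
        using member_le_sum[of i "{..r}" x] that sum False by simp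
      have "eval_mon w m = (\<Prod>i\<le>r. w i ^ x i)"
        using eval_mon_superset[of "{..r}" m] m by (simp add: x_def)
      then have "C * eval_mon w m = (\<Prod>i\<le>r. subst_poly N (Q i) ^ D * w i ^ x i)"
        by (simp add: C_def subst_poly_hom prod.distrib flip: prod_power_distrib)
      also have "\<dots> = (\<Prod>i\<le>r. subst_poly N (Q i ^ (D - x i) * P ^ x i))"
      proof (intro prod.cong refl)
        fix i assume "i \<in> {..r}"
        then have "subst_poly N (Q i) ^ D = subst_poly N (Q i) ^ (D - x i) * subst_poly N (Q i) ^ x i"
            "subst_poly N P = w i * subst_poly N (Q i)"
          using x_le[of i] PQ by (simp_all flip: power_add)
        then show "subst_poly N (Q i) ^ D * w i ^ x i = subst_poly N (Q i ^ (D - x i) * P ^ x i)"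
          by (simp add: subst_poly_hom power_mult_distrib mult_ac)
      qed
      also have "\<dots> = subst_poly N (\<Prod>i\<le>r. Q i ^ (D - x i) * P ^ x i)"
        by (simp add: subst_poly_prod)
      finally have eq: "C * eval_mon w m = subst_poly N (\<Prod>i\<le>r. Q i ^ (D - x i) * P ^ x i)" .
      have "homogeneous n (\<Sum>i\<le>r. h * (D - x i) + Suc h * x i) (\<Prod>i\<le>r. Q i ^ (D - x i) * P ^ x i)"
        by (intro homogeneous_prod homogeneous_mult homogeneous_power P Q) simp
      also have "(\<Sum>i\<le>r. h * (D - x i) + Suc h * x i) = (\<Sum>i\<le>r. h * D + x i)"
      proof (intro sum.cong refl)
        fix i assume "i \<in> {..r}"
        then have "h * (D - x i) + h * x i = h * D"
          using x_le[of i] by (simp flip: distrib_left)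
        then show "h * (D - x i) + Suc h * x i = h * D + x i" by simp
      qed
      also have "\<dots> = (\<Sum>i\<le>r. h * D) + k"
        by (simp only: sum.distrib sum)
      finally show ?thesis
        unfolding eq gr_def by (intro imageI) simp
    qed
    obtain p where p: "homogeneous r k p" "x = subst_poly w p"
      using less.prems unfolding gr_def by auto
    have expand: "C * x = (\<Sum>m\<in>Poly_Mapping.keys p. const (Poly_Mapping.lookup p m) * (C * eval_mon w m))"
      by (simp add: p(2) subst_poly_mon sum_distrib_left mult_ac)
    show ?case
      unfolding expand using homogeneousD[OF p(1)] by (intro gr_sum gr_const_mult *)
  qed
  then show ?thesis using that unfolding C_def by blast
qed

text \<open>All powers of \<open>w i\<close> have the common denominator \<open>C\<close>. By
  algebraic independence of the \<open>N j\<close> this says that \<open>Q i ^ m\<close> divides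
  \<open>C * P ^ m\<close> for every \<open>m\<close>, so \<open>P / Q i\<close> is almost integral
  and, having degree one, is a linear form.\<close>

lemma w_combination_of_N:
  assumes P: "homogeneous n (Suc h) P" and Q: "\<And>i. i \<le> r \<Longrightarrow> homogeneous n h (Q i)"
    and PQ: "\<And>i. i \<le> r \<Longrightarrow> subst_poly N P = w i * subst_poly N (Q i)"
    and Q_nonzero: "\<And>i. i \<le> r \<Longrightarrow> Q i \<noteq> 0"
    and indep: "\<And>U k. homogeneous n k U \<Longrightarrow> subst_poly N U = 0 \<Longrightarrow> U = 0"
    and i: "i \<le> r"
  shows "\<exists>c. w i = (\<Sum>j\<le>n. const (c j) * N j)"
proof -
  obtain D where D: "\<And>k x. x \<in> gr r w k \<Longrightarrow>
      subst_poly N ((\<Prod>i\<le>r. Q i) ^ D) * x \<in> gr n N ((\<Sum>i\<le>r. h * D) + k)"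
    using common_denominator[OF P Q PQ] by blast
  define C where "C = (\<Prod>i\<le>r. Q i) ^ D"
  have "C \<noteq> 0" using Q_nonzero by (simp add: C_def)
  have C: "homogeneous n (\<Sum>i\<le>r. h * D) C"
  proof -
    have "homogeneous n ((\<Sum>i\<le>r. h) * D) C"
      unfolding C_def by (intro homogeneous_power homogeneous_prod Q) simp
    then show ?thesis by (simp only: sum_distrib_right)
  qed
  have "Q i ^ m dvd C * P ^ m" for m
  proof -
    have "w i ^ m \<in> gr r w m"
      using gr_power[OF gr_gen[OF i, of w], of m] by simp
    from D[OF this] obtain U where U: "homogeneous n ((\<Sum>i\<le>r. h * D) + m) U"
        "subst_poly N C * w i ^ m = subst_poly N U"
      unfolding C_def gr_def by auto
    have "subst_poly N (C * P ^ m) = (subst_poly N C * w i ^ m) * subst_poly N (Q i) ^ m"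
      by (simp add: subst_poly_hom PQ[OF i] power_mult_distrib mult_ac)
    then have "subst_poly N (C * P ^ m + const (- 1) * (U * Q i ^ m)) = 0"
      by (simp add: subst_poly_hom U(2) const_uminus)
    moreover have "homogeneous n ((\<Sum>i\<le>r. h * D) + Suc h * m) (C * P ^ m + const (- 1) * (U * Q i ^ m))"
    proof (intro homogeneous_add homogeneous_const_mult)
      show "homogeneous n ((\<Sum>i\<le>r. h * D) + Suc h * m) (C * P ^ m)"
        by (intro homogeneous_mult homogeneous_power C P)
      have "homogeneous n (((\<Sum>i\<le>r. h * D) + m) + h * m) (U * Q i ^ m)"
        by (intro homogeneous_mult homogeneous_power U Q i)
      then show "homogeneous n ((\<Sum>i\<le>r. h * D) + Suc h * m) (U * Q i ^ m)"
        by (simp add: add.assoc)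
    qed
    ultimately have "C * P ^ m + const (- 1) * (U * Q i ^ m) = 0" using indep by blast
    then show ?thesis by (simp add: const_uminus)
  qed
  from almost_integral_linear[OF Q[OF i] Q_nonzero[OF i] \<open>C \<noteq> 0\<close> P this]
  obtain c where c: "P = (\<Sum>j\<le>n. const (c j) * Var j) * Q i" by blast
  have "subst_poly N (Q i) \<noteq> 0" using indep[OF Q[OF i]] Q_nonzero[OF i] by blast
  moreover have "w i * subst_poly N (Q i) = (\<Sum>j\<le>n. const (c j) * N j) * subst_poly N (Q i)"
    using PQ[OF i, symmetric] unfolding c by (simp add: subst_poly_hom)
  ultimately show ?thesis by auto
qed

text \<open>
  The two matrices expressing \<open>w\<close> and \<open>N\<close> through each other are inverse to one another, so
  comparing the traces of their products shows that they are square.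
\<close>

lemma square_invertible:
  assumes c: "\<And>i. i \<le> r \<Longrightarrow> w i = (\<Sum>j\<le>n. const (c i j) * N j)"
    and indep: "\<And>U k. homogeneous n k U \<Longrightarrow> subst_poly N U = 0 \<Longrightarrow> U = 0"
  shows "r = n"
    and "i \<le> r \<Longrightarrow> l \<le> r \<Longrightarrow> (\<Sum>j\<le>n. c i j * (of_nat (e l) * a l j)) = (if i = l then 1 else 0)"
    and "j \<le> n \<Longrightarrow> l \<le> n \<Longrightarrow> (\<Sum>i\<le>r. of_nat (e i) * a i j * c i l) = (if j = l then 1 else 0)"
proof -
  have cb: "(\<Sum>j\<le>n. c i j * (of_nat (e l) * a l j)) = (if i = l then 1 else 0)"
    if "i \<le> r" "l \<le> r" for i l
  proof -
    have "w i = (\<Sum>l\<le>r. const (\<Sum>j\<le>n. c i j * (of_nat (e l) * a l j)) * w l)"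
      using c[OF that(1)] unfolding N_def sum_distrib_left const_sum sum_distrib_right
      by (subst sum.swap) (simp add: const_mult mult_ac)
    moreover have "w i = (\<Sum>l\<le>r. const (if i = l then 1 else 0) * w l)"
      using that by (simp add: if_distrib[of const] if_distrib[of "\<lambda>x. x * _"] cong: if_cong)
    ultimately have "(\<Sum>l\<le>r. const ((\<Sum>j\<le>n. c i j * (of_nat (e l) * a l j)) - (if i = l then 1 else 0)) * w l) = 0"
      by (simp only: const_diff left_diff_distrib sum_subtractf) simp
    from w_independent[OF this that(2)] show ?thesis by simp
  qed
  have bc: "(\<Sum>i\<le>r. of_nat (e i) * a i j * c i l) = (if j = l then 1 else 0)"
    if "j \<le> n" "l \<le> n" for j l
  proof -
    have "N j = (\<Sum>i\<le>r. const (of_nat (e i) * a i j) * (\<Sum>l\<le>n. const (c i l) * N l))"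
      unfolding N_def[of j] by (intro sum.cong refl) (simp flip: c)
    then have "N j = (\<Sum>l\<le>n. const (\<Sum>i\<le>r. of_nat (e i) * a i j * c i l) * N l)"
      unfolding sum_distrib_left const_sum sum_distrib_right
      by (subst sum.swap) (simp add: const_mult mult_ac)
    moreover have "N j = (\<Sum>l\<le>n. const (if j = l then 1 else 0) * N l)"
      using that by (simp add: if_distrib[of const] if_distrib[of "\<lambda>x. x * _"] cong: if_cong)
    ultimately have "subst_poly N (lin n (\<lambda>l. (\<Sum>i\<le>r. of_nat (e i) * a i j * c i l) - (if j = l then 1 else 0))) = 0"
      unfolding subst_poly_lin by (simp only: const_diff left_diff_distrib sum_subtractf) simp
    from lin_eq_0D[OF indep[OF homogeneous_lin this] that(2)] show ?thesis by simp
  qed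
  have "(of_nat (Suc r) :: 'k) = (\<Sum>i\<le>r. \<Sum>j\<le>n. c i j * (of_nat (e i) * a i j))"
    by (simp add: cb)
  also have "\<dots> = (\<Sum>j\<le>n. \<Sum>i\<le>r. of_nat (e i) * a i j * c i j)"
    by (subst sum.swap) (simp add: mult_ac)
  also have "\<dots> = of_nat (Suc n)"
    by (simp add: bc)
  finally show "r = n" by (simp only: of_nat_eq_iff)
  show "i \<le> r \<Longrightarrow> l \<le> r \<Longrightarrow> (\<Sum>j\<le>n. c i j * (of_nat (e l) * a l j)) = (if i = l then 1 else 0)"
    by (rule cb)
  show "j \<le> n \<Longrightarrow> l \<le> n \<Longrightarrow> (\<Sum>i\<le>r. of_nat (e i) * a i j * c i l) = (if j = l then 1 else 0)"
    by (rule bc)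
qed

text \<open>The factors \<open>g\<close> and \<open>G\<close> express that \<open>M\<close> and
  \<open>N\<close> represent the same rational map. The inverse of \<open>M\<close> gives both the
  algebraic independence of the \<open>N j\<close> and a representation of each \<open>w i\<close>
  as a fraction in them.\<close>

lemma birational_imp_invertible:
  assumes M: "birational n M" and MN: "\<And>j. j \<le> n \<Longrightarrow> g * M j = G * N j"
    and gG: "g \<noteq> 0" "G \<noteq> 0"
  shows "r = n \<and> (\<exists>x. inverse_arrays n a x)"
proof -
  obtain H where H: "rational_map n H" "same_rational_map n (rat_comp H M) Var"
      "same_rational_map n (rat_comp M H) Var"
    using M unfolding birational_def by auto
  obtain h where h: "\<And>i. i \<le> n \<Longrightarrow> homogeneous n h (H i)"
    using H(1) unfolding rational_map_def by auto
  have HM: "subst_poly M (H i) * Var j = subst_poly M (H j) * Var i" if "i \<le> n" "j \<le> n" for i j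
    using H(2) that unfolding same_rational_map_def rat_comp_def by auto
  have MH: "subst_poly H (M i) * Var j = subst_poly H (M j) * Var i" if "i \<le> n" "j \<le> n" for i j
    using H(3) that unfolding same_rational_map_def rat_comp_def by auto
  obtain i0 where i0: "i0 \<le> n" "subst_poly M (H i0) \<noteq> 0"
    using H(2) unfolding same_rational_map_def rational_map_def rat_comp_def by auto
  obtain i1 where i1: "i1 \<le> n" "subst_poly H (M i1) \<noteq> 0"
    using H(3) unfolding same_rational_map_def rational_map_def rat_comp_def by auto
  \<comment> \<open>A form vanishing at \<open>N\<close> vanishes at the proportional tuple
    \<open>M\<close>, hence at \<open>M\<close> after \<open>H\<close>, which is proportional to the
    variables themselves.\<close>
  have indep: "U = 0" if U: "homogeneous n k U" "subst_poly N U = 0" for k U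
  proof -
    have "g ^ k * subst_poly M U = G ^ k * subst_poly N U"
      by (rule subst_poly_scale[OF U(1)]) (rule MN)
    then have "subst_poly M U = 0" using U(2) gG by simp
    then have "subst_poly (\<lambda>i. subst_poly H (M i)) U = 0"
      by (simp flip: subst_poly_subst_poly)
    moreover have "Var i1 ^ k * subst_poly (\<lambda>i. subst_poly H (M i)) U = subst_poly H (M i1) ^ k * subst_poly Var U"
      by (rule subst_poly_scale[OF U(1)]) (use MH i1 in \<open>simp add: mult.commute\<close>)
    ultimately show ?thesis using i1 by simp
  qed
  have scale: "g ^ h * subst_poly M (H i) = G ^ h * subst_poly N (H i)" if "i \<le> n" for i
    by (rule subst_poly_scale[OF h[OF that]]) (rule MN)
  have HN: "subst_poly N (H i) * Var j = subst_poly N (H j) * Var i" if "i \<le> n" "j \<le> n" for i j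
  proof -
    have "G ^ h * (subst_poly N (H i) * Var j) = g ^ h * (subst_poly M (H i) * Var j)"
      using scale[OF that(1)] by (simp add: mult.assoc[symmetric])
    also have "\<dots> = G ^ h * (subst_poly N (H j) * Var i)"
      using scale[OF that(2)] HM[OF that] by (simp add: mult.assoc[symmetric])
    finally show ?thesis using gG by simp
  qed
  have HN0: "subst_poly N (H i0) \<noteq> 0"
    using scale[OF i0(1)] i0(2) gG by auto
  \<comment> \<open>Since \<open>H\<close> evaluated at \<open>N\<close> is proportional to
    \<open>Var\<close>, the values of \<open>P\<close> and \<open>Q i\<close> at \<open>N\<close>
    are, up to one common factor, the Euler sum \<open>wt * W\<close> and \<open>wt * L i\<close>.
    Their quotient is \<open>w i\<close>.\<close>
  define P where "P = (\<Sum>j\<le>n. Var j * H j)"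
  define Q where "Q = (\<lambda>i. const (of_nat wt) * (\<Sum>j\<le>n. const (a i j) * H j))"
  have QN: "Var l * subst_poly N (Q i) = const (of_nat wt) * (L i * subst_poly N (H l))" if "l \<le> n" for i l
  proof -
    have "Var l * subst_poly N (Q i) = const (of_nat wt) * (\<Sum>j\<le>n. const (a i j) * (subst_poly N (H j) * Var l))"
      by (simp add: Q_def subst_poly_hom sum_distrib_left mult_ac)
    also have "(\<Sum>j\<le>n. const (a i j) * (subst_poly N (H j) * Var l)) =
        (\<Sum>j\<le>n. const (a i j) * (subst_poly N (H l) * Var j))"
      using HN that by (intro sum.cong) auto
    also have "\<dots> = L i * subst_poly N (H l)"
      by (simp add: L_def lin_def sum_distrib_left mult_ac)
    finally show ?thesis .
  qed
  have PN: "Var l * subst_poly N P = const (of_nat wt) * (W * subst_poly N (H l))" if "l \<le> n" for l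
  proof -
    have "Var l * subst_poly N P = (\<Sum>j\<le>n. N j * (subst_poly N (H j) * Var l))"
      by (simp add: P_def subst_poly_hom sum_distrib_left mult_ac)
    also have "\<dots> = (\<Sum>j\<le>n. N j * (subst_poly N (H l) * Var j))"
      using HN that by (intro sum.cong) auto
    also have "\<dots> = (\<Sum>j\<le>n. Var j * N j) * subst_poly N (H l)"
      by (simp add: sum_distrib_left mult_ac)
    finally show ?thesis by (simp add: euler_N mult.assoc)
  qed
  have PQ: "subst_poly N P = w i * subst_poly N (Q i)" if "i \<le> r" for i
  proof -
    have "Var 0 * subst_poly N P = Var 0 * (w i * subst_poly N (Q i))"
      using PN[of 0] QN[of 0 i] w_L[OF that, symmetric] by (simp add: mult_ac)
    then show ?thesis by simp
  qed
  have homP: "homogeneous n (Suc h) P"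
    unfolding P_def using homogeneous_mult[OF homogeneous_Var h] by (intro homogeneous_sum) auto
  have homQ: "homogeneous n h (Q i)" for i
    unfolding Q_def by (intro homogeneous_const_mult homogeneous_sum h) simp
  have Q0: "Q i \<noteq> 0" if "i \<le> r" for i
    using QN[OF i0(1), of i] HN0 L_nonzero[OF that] wt_nonzero by auto
  have "\<exists>c. w i = (\<Sum>j\<le>n. const (c j) * N j)" if "i \<le> r" for i
    by (rule w_combination_of_N[OF homP homQ PQ Q0 _ that]) (assumption | erule (1) indep)+
  then have "\<forall>i. \<exists>c. i \<le> r \<longrightarrow> w i = (\<Sum>j\<le>n. const (c j) * N j)" by blast
  then obtain c where c: "\<And>i. i \<le> r \<Longrightarrow> w i = (\<Sum>j\<le>n. const (c i j) * N j)"
    by metis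
  have rn: "r = n"
    by (rule square_invertible(1)[of c]) (erule c, erule (1) indep)
  have cb: "(\<Sum>j\<le>n. c i j * (of_nat (e l) * a l j)) = (if i = l then 1 else 0)"
    if "i \<le> r" "l \<le> r" for i l
    by (rule square_invertible(2)[OF _ _ that]) (erule c, erule (1) indep)
  have bc: "(\<Sum>i\<le>r. of_nat (e i) * a i j * c i l) = (if j = l then 1 else 0)"
    if "j \<le> n" "l \<le> n" for j l
    by (rule square_invertible(3)[OF _ _ that]) (erule c, erule (1) indep)
  \<comment> \<open>The array \<open>c\<close> inverts the weighted matrix with entries
    \<open>e i * a i j\<close>. Moving the weights into \<open>c\<close> gives an inverse of
    \<open>a\<close> itself.\<close>
  define x where "x = (\<lambda>j i. of_nat (e i) * c i j)"
  have "inverse_arrays n a x"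
    unfolding inverse_arrays_def
  proof (intro conjI allI impI)
    fix i l assume il: "i \<le> n" "l \<le> n"
    have "of_nat (e i) * (\<Sum>j\<le>n. a i j * x j l) = of_nat (e l) * (\<Sum>j\<le>n. c l j * (of_nat (e i) * a i j))"
      by (simp add: x_def sum_distrib_left mult_ac)
    also have "\<dots> = of_nat (e i) * (if i = l then 1 else 0)"
      using cb[of l i] il rn by auto
    finally show "(\<Sum>j\<le>n. a i j * x j l) = (if i = l then 1 else 0)"
      using e_pos[of i] il rn by simp
    show "(\<Sum>j\<le>n. x i j * a j l) = (if i = l then 1 else 0)"
      using bc[OF il(2,1)] rn by (auto simp: x_def mult_ac)
  qed
  then show ?thesis using rn by blast
qed

end

section \<open>Congruences, complementary products and representatives of rational maps\<close>

text \<open>Powers, products and sums respect congruence modulo \<open>d\<close>. For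
  \<open>d = L i\<close> this turns vanishing on the hyperplane into divisibility by
  \<open>L i\<close>.\<close>

lemma dvd_subst_poly_diff:
  assumes "\<And>j. d dvd G j - H j"
  shows "d dvd subst_poly G p - subst_poly H p"
proof -
  have pow: "d dvd x ^ k - y ^ k" if "d dvd x - y" for x y :: "'a mpoly" and k
    using that dvd_trans[OF _ dvd_triv_left, of d "x - y"] power_diff_sumr2[of x k y] by simp
  have "d dvd prod f S - prod g S" if "finite S" "\<And>i. d dvd f i - g i"
    for f g :: "nat \<Rightarrow> 'a mpoly" and S
    using that(1)
  proof (induction S rule: finite_induct)
    case (insert s S)
    have "f s * prod f S - g s * prod g S = f s * (prod f S - prod g S) + (f s - g s) * prod g S"
      by (simp add: algebra_simps)
    then show ?case
      using insert that(2)[of s] by simp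
  qed simp
  then have "d dvd eval_mon G m - eval_mon H m" for m
    unfolding eval_mon_def using pow[OF assms] by simp
  then have "d dvd const (Poly_Mapping.lookup p m) * eval_mon G m - const (Poly_Mapping.lookup p m) * eval_mon H m" for m
    by (simp flip: right_diff_distrib)
  then show ?thesis
    unfolding subst_poly_mon by (simp add: dvd_sum flip: sum_subtractf)
qed

text \<open>This is the involutivity of the standard Cremona transformation, with its extraneous
  factor. The product of all \<open>n + 1\<close> complementary products is the \<open>n\<close>-th
  power of the full product; dividing by the one with index \<open>i\<close> leaves the
  claim.\<close>

lemma prod_of_complementary_prods:
  fixes f :: "nat \<Rightarrow> 'a::idom"
  assumes "n \<ge> 1" "\<And>i. i \<le> n \<Longrightarrow> f i \<noteq> 0" and i: "i \<le> n"
  shows "(\<Prod>k\<in>{..n} - {i}. \<Prod>l\<in>{..n} - {k}. f l) = (\<Prod>l\<le>n. f l) ^ (n - 1) * f i"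
proof -
  let ?F = "\<Prod>l\<le>n. f l" and ?v = "\<lambda>k. \<Prod>l\<in>{..n} - {k}. f l"
  have F: "?F \<noteq> 0" using assms(2) by simp
  have v: "?F = f k * ?v k" if "k \<le> n" for k
    using that by (intro prod.remove) auto
  have "?F * (\<Prod>k\<le>n. ?v k) = (\<Prod>k\<le>n. ?F)"
    unfolding prod.distrib[symmetric] using v by (intro prod.cong) auto
  then have "?F * (\<Prod>k\<le>n. ?v k) = ?F * ?F ^ n" by simp
  then have "?F ^ n = (\<Prod>k\<le>n. ?v k)" using F by simp
  also have "\<dots> = ?v i * (\<Prod>k\<in>{..n} - {i}. ?v k)"
    using i by (intro prod.remove) auto
  finally have "?v i * (\<Prod>k\<in>{..n} - {i}. ?v k) = ?F ^ (n - 1) * ?F"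
    using assms(1) by (simp flip: power_Suc2)
  also have "\<dots> = ?v i * (?F ^ (n - 1) * f i)"
    using v[OF i] by (simp add: mult_ac)
  finally show ?thesis using assms(2) i by auto
qed

lemma same_rational_mapI:
  assumes "rational_map n K" "s \<noteq> 0" "\<And>i. i \<le> n \<Longrightarrow> homogeneous n d (G i)"
    and G: "\<And>i. i \<le> n \<Longrightarrow> G i = s * K i"
  shows "same_rational_map n G K"
  using assms unfolding same_rational_map_def rational_map_def by (auto simp: mult_ac)

lemma rational_map_Var: "rational_map n Var"
  unfolding rational_map_def using homogeneous_Var Var_neq_0 by blast

lemma rational_map_lin:
  assumes "(\<Sum>j\<le>n. f 0 j * g j) \<noteq> 0"
  shows "rational_map n (\<lambda>i. lin n (f i))"
proof -
  have "lin n (f 0) \<noteq> 0"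
  proof
    assume "lin n (f 0) = 0"
    from lin_eq_0D[OF this] show False using assms by simp
  qed
  then show ?thesis unfolding rational_map_def using homogeneous_lin by blast
qed

lemma same_rational_map_cong:
  assumes "rational_map n G" "\<And>i. i \<le> n \<Longrightarrow> K i = G i"
  shows "same_rational_map n G K"
proof -
  have "rational_map n K" using assms by (auto simp: rational_map_def)
  then show ?thesis using assms by (simp add: same_rational_map_def mult.commute)
qed

lemma projectivity_lin:
  assumes inv: "inverse_arrays n f g"
  shows "projectivity n (\<lambda>i. lin n (f i))"
proof -
  have fg: "(\<Sum>j\<le>n. f i j * g j l) = (if i = l then 1 else 0)"
    and gf: "(\<Sum>j\<le>n. g i j * f j l) = (if i = l then 1 else 0)" if "i \<le> n" "l \<le> n" for i l
    using inv that by (simp_all add: inverse_arrays_def)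
  define A B where "A = mat (n + 1) (n + 1) (\<lambda>(i, j). f i j)" and "B = mat (n + 1) (n + 1) (\<lambda>(i, j). g i j)"
  have *: "{0..<Suc n} = {..n}" by auto
  have "A * B = 1\<^sub>m (n + 1)"
    by (rule eq_matI) (auto simp: A_def B_def scalar_prod_def * fg less_Suc_eq_le)
  moreover have "B * A = 1\<^sub>m (n + 1)"
    by (rule eq_matI) (auto simp: A_def B_def scalar_prod_def * gf less_Suc_eq_le)
  ultimately have "invertible_mat A"
    unfolding invertible_mat_def inverts_mat_def by (auto simp: A_def B_def)
  moreover have "rational_map n (\<lambda>i. lin n (f i))"
    by (rule rational_map_lin[where g = "\<lambda>j. g j 0"]) (simp add: fg)
  moreover have "lin n (f i) = linear_map n A i" if "i \<le> n" for i
    unfolding lin_def linear_map_def using that by (intro sum.cong) (auto simp: A_def)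
  ultimately show ?thesis
    unfolding projectivity_def
    by (intro bexI[of _ A] conjI same_rational_map_cong) (simp_all add: A_def)
qed

lemma homogeneous_cremona_tuple: "i \<le> n \<Longrightarrow> homogeneous n n (cremona_tuple n i)"
  using homogeneous_prod[of "{..n} - {i}" n "\<lambda>_. 1" Var] homogeneous_Var[of _ n]
  by (auto simp: cremona_tuple_def)

lemma rational_map_cremona_tuple: "rational_map n (cremona_tuple n)"
proof -
  have "cremona_tuple n 0 \<noteq> (0 :: 'a mpoly)" by (simp add: cremona_tuple_def)
  then show ?thesis
    unfolding rational_map_def using homogeneous_cremona_tuple by blast
qed

lemma standard_cremona_cremona_tuple: "standard_cremona n (cremona_tuple n)"
proof -
  let ?I = "1\<^sub>m (n + 1)"
  have lin: "linear_map n ?I i = Var i" if "i \<le> n" for i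
    using that by (simp add: linear_map_def if_distrib[of const] if_distrib[of "\<lambda>x. x * _"] cong: if_cong)
  \<comment> \<open>The identity matrix represents \<open>Var\<close> only at indices up to
    \<open>n\<close>, so the substitutions are compared on polynomials in these variables.\<close>
  have crem: "rat_comp (cremona_tuple n) (linear_map n ?I) i = cremona_tuple n i" if "i \<le> n" for i
  proof -
    have "subst_poly (linear_map n ?I) (cremona_tuple n i) = subst_poly Var (cremona_tuple n i)"
      by (rule subst_poly_cong[OF homogeneous_polys[OF homogeneous_cremona_tuple[OF that]]]) (rule lin)
    then show ?thesis by (simp add: rat_comp_def)
  qed
  have "rat_comp (linear_map n (transpose_mat ?I)) (rat_comp (cremona_tuple n) (linear_map n ?I)) i
      = cremona_tuple n i" if "i \<le> n" for i
    unfolding transpose_one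
    by (subst rat_comp_def) (simp only: lin[OF that] subst_poly_Var crem[OF that])
  then have "same_rational_map n (cremona_tuple n)
      (rat_comp (linear_map n (transpose_mat ?I)) (rat_comp (cremona_tuple n) (linear_map n ?I)))"
    by (rule same_rational_map_cong[OF rational_map_cremona_tuple])
  moreover have "invertible_mat (?I :: 'a mat)"
    unfolding invertible_mat_def inverts_mat_def by (auto intro!: exI[of _ ?I])
  ultimately show ?thesis
    unfolding standard_cremona_def by (intro bexI[of _ ?I]) auto
qed

section \<open>The gradient and its common factors\<close>

context arrangement
begin

text \<open>On the hyperplane \<open>L i = 0\<close> the form \<open>L k\<close> is not zero, so
  \<open>u\<close> must vanish there. As \<open>u\<close> is congruent to its restriction modulo
  \<open>L i\<close>, it is divisible by \<open>L i\<close>.\<close>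

lemma L_dvd_cancel:
  assumes "i \<le> r" "k \<le> r" "k \<noteq> i" "L i dvd u * L k"
  shows "L i dvd u"
proof -
  obtain \<sigma> where \<sigma>: "subst_poly \<sigma> (L i) = 0" "\<And>k. k \<le> r \<Longrightarrow> k \<noteq> i \<Longrightarrow> subst_poly \<sigma> (L k) \<noteq> 0"
      "\<And>j. L i dvd \<sigma> j - Var j"
    using hyperplane_substitution[OF assms(1)] by blast
  obtain v where "u * L k = L i * v" using assms(4) by (elim dvdE)
  from arg_cong[OF this, of "subst_poly \<sigma>"] have "subst_poly \<sigma> u = 0"
    using \<sigma>(1) \<sigma>(2)[OF assms(2,3)] by (simp add: subst_poly_mult)
  moreover have "L i dvd subst_poly \<sigma> u - subst_poly Var u"
    by (rule dvd_subst_poly_diff) (rule \<sigma>(3))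
  ultimately show ?thesis by simp
qed

text \<open>Writing \<open>u * L i = h * x\<close> and \<open>u * L k = h * y\<close> gives
  \<open>x * L k = y * L i\<close>. Hence \<open>L i\<close> divides \<open>x\<close> and cancels
  from the first equation.\<close>

lemma dvd_mult_L_cancel:
  assumes "i \<le> r" "k \<le> r" "k \<noteq> i" "h dvd u * L i" "h dvd u * L k"
  shows "h dvd u"
proof -
  obtain x y where x: "u * L i = h * x" and y: "u * L k = h * y" using assms(4,5) by (elim dvdE)
  show ?thesis
  proof (cases "h = 0")
    case True
    then show ?thesis using x L_nonzero[OF assms(1)] by simp
  next
    case False
    have "h * (x * L k) = (u * L i) * L k" unfolding x by (simp only: mult_ac)
    also have "\<dots> = (u * L k) * L i" by (simp only: mult_ac)
    also have "\<dots> = h * (y * L i)" unfolding y by (simp only: mult_ac)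
    finally have "L i dvd x * L k" using False by simp
    then obtain x' where "x = L i * x'" using L_dvd_cancel assms by (meson dvdE)
    then have "u * L i = (h * x') * L i" using x by (simp add: mult_ac)
    then show ?thesis using L_nonzero[OF assms(1)] by simp
  qed
qed

text \<open>The complementary products have no common factor. When \<open>t\<close> is added to
  \<open>T\<close>, the hypotheses for \<open>t\<close> and for \<open>i\<close> contain the product
  over \<open>T - {i}\<close> times \<open>L i\<close> and times \<open>L t\<close>, and these two
  coprime factors cancel.\<close>

lemma dvd_complementary_prods:
  assumes "finite T" "T \<noteq> {}" "T \<subseteq> {..r}" "\<And>i. i \<in> T \<Longrightarrow> h dvd u * (\<Prod>k\<in>T - {i}. L k)"
  shows "h dvd u"
  using assms
proof (induction T rule: finite_ne_induct)
  case (insert t T)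
  have "h dvd u * (\<Prod>k\<in>T - {i}. L k)" if i: "i \<in> T" for i
  proof (rule dvd_mult_L_cancel)
    show "i \<le> r" "t \<le> r" "t \<noteq> i" using insert that by auto
    have "insert t T - {t} = T" using insert by auto
    moreover have "(\<Prod>k\<in>T. L k) = L i * (\<Prod>k\<in>T - {i}. L k)"
      using insert.hyps(1) i by (rule prod.remove)
    ultimately show "h dvd u * (\<Prod>k\<in>T - {i}. L k) * L i"
      using insert.prems(2)[of t] by (simp add: mult_ac)
    have "insert t T - {i} = insert t (T - {i})" using insert i by auto
    then show "h dvd u * (\<Prod>k\<in>T - {i}. L k) * L t"
      using insert.prems(2)[of i] insert.hyps i by (simp add: mult_ac)
  qed
  then show ?case using insert by auto
qed simp

definition F where "F = (\<Prod>i\<le>r. L i ^ e i)"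
text \<open>The base component of the polar system: \<open>is_gcd_G\<close> shows that it is the
  full common factor once the coefficient matrix is invertible.\<close>

definition G where "G = (\<Prod>i\<le>r. L i ^ (e i - 1))"

lemma G_nonzero: "G \<noteq> 0"
  unfolding G_def by (simp add: L_nonzero)

lemma homogeneous_G: "homogeneous n (\<Sum>i\<le>r. 1 * (e i - 1)) G"
  unfolding G_def by (intro homogeneous_prod homogeneous_power homogeneous_L)

lemma homogeneous_F: "homogeneous n wt F"
proof -
  have "homogeneous n (\<Sum>i\<le>r. 1 * e i) F"
    unfolding F_def by (intro homogeneous_prod homogeneous_power homogeneous_L)
  then show ?thesis by (simp add: wt_def)
qed

text \<open>In the product rule each factor \<open>L k ^ e k\<close> still contains
  \<open>L k ^ (e k - 1)\<close> after at most one differentiation; these powers make up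
  \<open>G\<close>.\<close>

lemma gradient:
  assumes "j \<le> n"
  shows "polar_map F j = G * N j"
proof -
  have L: "pderiv_var j (L i) = const (a i j)" for i
    unfolding L_def lin_def using assms by (rule pderiv_var_linear_form)
  have "pderiv_var j (L i ^ e i) * (\<Prod>k\<in>{..r} - {i}. L k ^ e k)
      = G * (const (of_nat (e i) * a i j) * w i)" if "i \<le> r" for i
  proof -
    have "(\<Prod>k\<in>{..r} - {i}. L k ^ e k) = (\<Prod>k\<in>{..r} - {i}. L k ^ (e k - 1) * L k)"
    proof (rule prod.cong[OF refl])
      fix k assume "k \<in> {..r} - {i}"
      then have "e k > 0" using e_pos[of k] by simp
      then show "L k ^ e k = L k ^ (e k - 1) * L k" by (simp only: power_minus_mult)
    qed
    moreover have "G = L i ^ (e i - 1) * (\<Prod>k\<in>{..r} - {i}. L k ^ (e k - 1))"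
      unfolding G_def using that by (intro prod.remove) auto
    ultimately show ?thesis
      by (simp add: pderiv_var_power L w_def prod.distrib const_mult mult_ac)
  qed
  then show ?thesis
    unfolding polar_map_def F_def N_def by (simp add: pderiv_var_prod sum_distrib_left)
qed

lemma homaloidal_imp_invertible:
  assumes "homaloidal n F"
  shows "r = n \<and> (\<exists>x. inverse_arrays n a x)"
proof -
  obtain g M where g: "g \<noteq> 0" "\<And>j. j \<le> n \<Longrightarrow> polar_map F j = g * M j" and M: "birational n M"
    using assms unfolding homaloidal_def moving_part_def by blast
  have "g * M j = G * N j" if "j \<le> n" for j
    using g(2)[OF that] gradient[OF that] by simp
  from birational_imp_invertible[OF M this g(1) G_nonzero] show ?thesis .
qed

end

section \<open>Sufficiency: the explicit inverse for an invertible coefficient matrix\<close>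

locale square_arrangement = arrangement n n a e
  for n and a :: "nat \<Rightarrow> nat \<Rightarrow> 'k::field_char_0" and e +
  fixes x :: "nat \<Rightarrow> nat \<Rightarrow> 'k"
  assumes n_pos: "n \<ge> 1"
    and inverse: "inverse_arrays n a x"
begin

lemma ax: "i \<le> n \<Longrightarrow> l \<le> n \<Longrightarrow> (\<Sum>j\<le>n. a i j * x j l) = (if i = l then 1 else 0)"
  and xa: "i \<le> n \<Longrightarrow> l \<le> n \<Longrightarrow> (\<Sum>j\<le>n. x i j * a j l) = (if i = l then 1 else 0)"
  using inverse by (simp_all add: inverse_arrays_def)

lemma e_nonzero: "i \<le> n \<Longrightarrow> e i \<noteq> 0"
  using e_pos[of i] by auto

lemma sum_ax: "i \<le> n \<Longrightarrow> (\<Sum>l\<le>n. const (\<Sum>j\<le>n. a i j * x j l) * f l) = f i"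
  by (simp add: ax if_distrib[of const] if_distrib[of "\<lambda>x. x * _"] cong: if_cong)

lemma sum_xa: "i \<le> n \<Longrightarrow> (\<Sum>l\<le>n. const (\<Sum>j\<le>n. x i j * a j l) * f l) = f i"
  by (simp add: xa if_distrib[of const] if_distrib[of "\<lambda>x. x * _"] cong: if_cong)

lemma sum_const_sum:
  "(\<Sum>j\<le>n. const (p j) * (\<Sum>l\<le>n. const (q j l) * f l)) = (\<Sum>l\<le>n. const (\<Sum>j\<le>n. p j * q j l) * f l)"
  unfolding sum_distrib_left const_sum sum_distrib_right
  by (subst sum.swap) (simp add: const_mult mult_ac)

text \<open>The definition of \<open>N\<close> is a linear system in the \<open>w i\<close>.
  Dividing the inverse \<open>x\<close> by the weights inverts its matrix.\<close>

lemma w_eq: "i \<le> n \<Longrightarrow> w i = (\<Sum>j\<le>n. const (x j i / of_nat (e i)) * N j)"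
proof -
  assume i: "i \<le> n"
  have "(\<Sum>j\<le>n. const (x j i / of_nat (e i)) * N j)
      = (\<Sum>l\<le>n. const (\<Sum>j\<le>n. x j i / of_nat (e i) * (of_nat (e l) * a l j)) * w l)"
    unfolding N_def by (rule sum_const_sum)
  also have "\<dots> = (\<Sum>l\<le>n. const (of_nat (e l) / of_nat (e i) * (\<Sum>j\<le>n. a l j * x j i)) * w l)"
    by (simp add: sum_distrib_left mult_ac)
  also have "\<dots> = (\<Sum>l\<le>n. if l = i then w i else 0)"
    by (intro sum.cong refl) (use i e_nonzero[OF i] in \<open>auto simp: ax\<close>)
  finally show ?thesis using i by simp
qed

lemma w_nonzero: "i \<le> n \<Longrightarrow> w i \<noteq> 0"
  unfolding w_def by (simp add: L_nonzero)

lemma rational_map_N: "rational_map n N"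
proof -
  have "\<exists>j\<le>n. N j \<noteq> 0"
    using w_eq[of 0] w_nonzero[of 0] by (metis (no_types, lifting) atMost_iff le0 mult_zero_right sum.neutral)
  then show ?thesis unfolding rational_map_def using homogeneous_N by blast
qed

text \<open>A common divisor of the \<open>G * N j\<close> divides every \<open>G * w i\<close> by
  \<open>w_eq\<close>, and the complementary products \<open>w i\<close> have no common
  factor.\<close>

lemma is_gcd_G: "is_gcd n (polar_map F) G"
  unfolding is_gcd_def
proof (intro conjI allI impI)
  show "G \<in> polys n" using homogeneous_G by (rule homogeneous_polys)
  show "G dvd polar_map F i" if "i \<le> n" for i using gradient[OF that] by simp
  fix h assume "\<forall>i\<le>n. h dvd polar_map F i"
  then have h: "h dvd G * N j" if "j \<le> n" for j using gradient that by metis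
  show "h dvd G"
  proof (rule dvd_complementary_prods[of "{..n}"])
    fix i assume "i \<in> {..n}"
    then have "G * (\<Prod>k\<in>{..n} - {i}. L k) = (\<Sum>j\<le>n. const (x j i / of_nat (e i)) * (G * N j))"
      using w_eq[of i] by (simp add: w_def sum_distrib_left mult_ac)
    then show "h dvd G * (\<Prod>k\<in>{..n} - {i}. L k)" using h by (auto intro!: dvd_sum)
  qed auto
qed

text \<open>\<open>z k\<close> recovers \<open>w k\<close> from \<open>N\<close>, and \<open>H\<close> is the inverse of \<open>N\<close>.\<close>

definition z where "z k = lin n (\<lambda>j. x j k / of_nat (e k))"
definition v where "v i = (\<Prod>k\<in>{..n} - {i}. z k)"
definition H where "H j = (\<Sum>i\<le>n. const (x j i) * v i)"

lemma subst_N_z: "k \<le> n \<Longrightarrow> subst_poly N (z k) = w k"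
  by (simp add: z_def subst_poly_lin w_eq)

lemma z_nonzero: "k \<le> n \<Longrightarrow> z k \<noteq> 0"
  using subst_N_z[of k] w_nonzero[of k] by auto

lemma homogeneous_H: "homogeneous n n (H j)"
proof -
  have "homogeneous n n (v i)" if "i \<le> n" for i
  proof -
    have "homogeneous n (\<Sum>k\<in>{..n} - {i}. 1) (v i)"
      unfolding v_def z_def by (intro homogeneous_prod homogeneous_lin)
    then show ?thesis using that by simp
  qed
  then show ?thesis unfolding H_def by (intro homogeneous_sum homogeneous_const_mult) auto
qed

text \<open>At \<open>N\<close> each \<open>z k\<close> becomes \<open>w k\<close>, so
  \<open>v i\<close> becomes \<open>L i\<close> times a power of \<open>W\<close> by Cremona
  involutivity. The array \<open>x\<close> then recovers the variables from the forms.\<close>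

lemma subst_N_H:
  assumes "j \<le> n"
  shows "subst_poly N (H j) = W ^ (n - 1) * Var j"
proof -
  have "subst_poly N (v i) = W ^ (n - 1) * L i" if "i \<le> n" for i
  proof -
    have "subst_poly N (v i) = (\<Prod>k\<in>{..n} - {i}. w k)"
      unfolding v_def subst_poly_prod by (intro prod.cong) (auto simp: subst_N_z)
    then show ?thesis
      unfolding w_def W_def using prod_of_complementary_prods[OF n_pos L_nonzero that] by simp
  qed
  then have "subst_poly N (H j) = (\<Sum>i\<le>n. const (x j i) * (W ^ (n - 1) * L i))"
    unfolding H_def subst_poly_sum subst_poly_mult by simp
  also have "\<dots> = W ^ (n - 1) * (\<Sum>i\<le>n. const (x j i) * (\<Sum>l\<le>n. const (a i l) * Var l))"
    by (simp add: L_def lin_def sum_distrib_left mult_ac)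
  also have "\<dots> = W ^ (n - 1) * Var j"
    unfolding sum_const_sum sum_xa[OF assms] ..
  finally show ?thesis .
qed

text \<open>The mirror computation: at \<open>H\<close> each \<open>L k\<close> becomes
  \<open>v k\<close>, so \<open>w i\<close> becomes \<open>z i\<close> times a common factor, and
  the weighted matrix sends the \<open>z i\<close> back to the variables.\<close>

lemma subst_H_N:
  assumes "j \<le> n"
  shows "subst_poly H (N j) = (\<Prod>k\<le>n. z k) ^ (n - 1) * Var j"
proof -
  have L: "subst_poly H (L k) = v k" if "k \<le> n" for k
    unfolding L_def subst_poly_lin H_def sum_const_sum by (rule sum_ax[OF that])
  have w: "subst_poly H (w i) = (\<Prod>k\<le>n. z k) ^ (n - 1) * z i" if "i \<le> n" for i
  proof -
    have "subst_poly H (w i) = (\<Prod>k\<in>{..n} - {i}. v k)"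
      unfolding w_def subst_poly_prod by (intro prod.cong) (auto simp: L)
    then show ?thesis
      unfolding v_def using prod_of_complementary_prods[OF n_pos z_nonzero that] by simp
  qed
  have "subst_poly H (N j) = (\<Sum>i\<le>n. const (of_nat (e i) * a i j) * ((\<Prod>k\<le>n. z k) ^ (n - 1) * z i))"
    unfolding N_def subst_poly_sum subst_poly_mult by (simp add: w)
  also have "\<dots> = (\<Prod>k\<le>n. z k) ^ (n - 1) * (\<Sum>i\<le>n. const (of_nat (e i) * a i j) * z i)"
    by (simp add: sum_distrib_left mult_ac)
  also have "(\<Sum>i\<le>n. const (of_nat (e i) * a i j) * z i)
      = (\<Sum>l\<le>n. const (\<Sum>i\<le>n. of_nat (e i) * a i j * (x l i / of_nat (e i))) * Var l)"
    unfolding z_def lin_def by (rule sum_const_sum)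
  also have "\<dots> = (\<Sum>l\<le>n. const (\<Sum>i\<le>n. x l i * a i j) * Var l)"
    by (simp add: e_nonzero mult.commute cong: sum.cong_simp)
  also have "\<dots> = (\<Sum>l\<le>n. if l = j then Var l else 0)"
    by (intro sum.cong refl) (use assms in \<open>auto simp: xa\<close>)
  also have "\<dots> = Var j" using assms by simp
  finally show ?thesis .
qed

lemma birational_N: "birational n N"
proof -
  have "H 0 \<noteq> 0" using subst_N_H[of 0] W_nonzero by auto
  then have H: "rational_map n H"
    unfolding rational_map_def using homogeneous_H by auto
  have "same_rational_map n (rat_comp H N) Var"
  proof (rule same_rational_mapI[OF rational_map_Var])
    show "W ^ (n - 1) \<noteq> 0" using W_nonzero by simp
    show "homogeneous n (n * n) (rat_comp H N i)" for i
      unfolding rat_comp_def by (rule homogeneous_subst_poly[OF homogeneous_H homogeneous_N])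
    show "rat_comp H N i = W ^ (n - 1) * Var i" if "i \<le> n" for i
      unfolding rat_comp_def by (rule subst_N_H[OF that])
  qed
  moreover have "same_rational_map n (rat_comp N H) Var"
  proof (rule same_rational_mapI[OF rational_map_Var])
    show "(\<Prod>k\<le>n. z k) ^ (n - 1) \<noteq> 0" using z_nonzero by simp
    show "homogeneous n (n * n) (rat_comp N H i)" for i
      unfolding rat_comp_def by (rule homogeneous_subst_poly[OF homogeneous_N homogeneous_H])
    show "rat_comp N H i = (\<Prod>k\<le>n. z k) ^ (n - 1) * Var i" if "i \<le> n" for i
      unfolding rat_comp_def by (rule subst_H_N[OF that])
  qed
  ultimately show ?thesis
    unfolding birational_def using rational_map_N H by blast
qed

lemma homaloidal_F: "homaloidal n F"
proof -
  have "wt \<ge> 1" using wt_nonzero by (cases "wt = 0") auto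
  moreover have "moving_part n (polar_map F) N"
    unfolding moving_part_def using G_nonzero is_gcd_G gradient by blast
  ultimately show ?thesis
    unfolding homaloidal_def using homogeneous_F birational_N by blast
qed

text \<open>Substituting the \<open>L i\<close> into the Cremona tuple gives the \<open>w i\<close>,
  and the transposed weighted matrix combines these into the \<open>N j\<close>. The exponents enter
  only in the last projectivity and in the discarded factor \<open>G\<close>.\<close>

lemma polar_map_decomposition:
  "\<exists>P C Q. projectivity n P \<and> standard_cremona n C \<and> projectivity n Q \<and>
     same_rational_map n (polar_map F) (rat_comp P (rat_comp C Q))"
proof -
  let ?P = "\<lambda>j. lin n (\<lambda>i. of_nat (e i) * a i j)" and ?Q = L
  have Q: "projectivity n ?Q"
    unfolding L_def using inverse by (rule projectivity_lin)
  have P: "projectivity n ?P"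
  proof (rule projectivity_lin[where g = "\<lambda>i l. x l i / of_nat (e i)"],
      unfold inverse_arrays_def, intro conjI allI impI)
    fix i l assume il: "i \<le> n" "l \<le> n"
    have "(\<Sum>j\<le>n. of_nat (e j) * a j i * (x l j / of_nat (e j))) = (\<Sum>j\<le>n. x l j * a j i)"
      by (intro sum.cong) (simp_all add: e_nonzero)
    then show "(\<Sum>j\<le>n. of_nat (e j) * a j i * (x l j / of_nat (e j))) = (if i = l then 1 else 0)"
      using il by (auto simp: xa)
    have "(\<Sum>j\<le>n. x j i / of_nat (e i) * (of_nat (e l) * a l j))
        = of_nat (e l) / of_nat (e i) * (\<Sum>j\<le>n. a l j * x j i)"
      by (simp add: sum_distrib_left mult_ac)
    then show "(\<Sum>j\<le>n. x j i / of_nat (e i) * (of_nat (e l) * a l j)) = (if i = l then 1 else 0)"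
      using il by (auto simp: ax e_nonzero)
  qed
  have "subst_poly L (cremona_tuple n i) = w i" for i
    by (simp add: cremona_tuple_def w_def subst_poly_prod)
  then have comp: "rat_comp ?P (rat_comp (cremona_tuple n) ?Q) j = N j" for j
    unfolding rat_comp_def subst_poly_lin N_def by simp
  have "same_rational_map n (polar_map F) (rat_comp ?P (rat_comp (cremona_tuple n) ?Q))"
  proof (rule same_rational_mapI)
    show "rational_map n (rat_comp ?P (rat_comp (cremona_tuple n) ?Q))"
      using rational_map_N by (simp add: rational_map_def comp)
    show "G \<noteq> 0" by (rule G_nonzero)
    show "homogeneous n ((\<Sum>i\<le>n. 1 * (e i - 1)) + n) (polar_map F i)" if "i \<le> n" for i
      unfolding gradient[OF that] by (intro homogeneous_mult homogeneous_G homogeneous_N)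
    show "polar_map F i = G * rat_comp ?P (rat_comp (cremona_tuple n) ?Q) i" if "i \<le> n" for i
      unfolding comp by (rule gradient[OF that])
  qed
  then show ?thesis using P Q standard_cremona_cremona_tuple by blast
qed

lemma L_independent:
  assumes "(\<Sum>i\<le>n. const (c i) * L i) = 0" "k \<le> n"
  shows "c k = 0"
proof -
  have "lin n (\<lambda>l. \<Sum>i\<le>n. c i * a i l) = 0"
    using assms(1) unfolding L_def lin_def sum_const_sum .
  from lin_eq_0D[OF this] have "(\<Sum>l\<le>n. (\<Sum>i\<le>n. c i * a i l) * x l k) = 0" by simp
  moreover have "(\<Sum>l\<le>n. (\<Sum>i\<le>n. c i * a i l) * x l k) = (\<Sum>i\<le>n. c i * (\<Sum>l\<le>n. a i l * x l k))"
    unfolding sum_distrib_left sum_distrib_right by (subst sum.swap) (simp add: mult_ac)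
  ultimately show ?thesis
    using assms(2) by (simp add: ax if_distrib[of "\<lambda>x. _ * x"] cong: if_cong)
qed

end

section \<open>Comparison of the weighted and the reduced product\<close>

theorem theoremB:
  fixes n r :: nat
    and L :: "nat \<Rightarrow> 'k::field_char_0 mpoly"
    and e :: "nat \<Rightarrow> nat"
    and F F_red :: "'k mpoly"
  assumes "n \<ge> 1"
    and "\<And>i. i \<le> r \<Longrightarrow> linear_form n (L i)"
    and "\<And>i. i \<le> r \<Longrightarrow> L i \<noteq> 0"
    and "\<And>i j c. i \<le> r \<Longrightarrow> j \<le> r \<Longrightarrow> i \<noteq> j \<Longrightarrow> L i \<noteq> const c * L j"
    and "\<And>i. i \<le> r \<Longrightarrow> e i \<ge> 1"
    and "F = (\<Prod>i\<le>r. L i ^ e i)"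
    and "F_red = (\<Prod>i\<le>r. L i)"
  shows "(homaloidal n F \<longleftrightarrow> homaloidal n F_red) \<and>
    (homaloidal n F \<longrightarrow>
       r = n \<and>
       (\<forall>c. (\<Sum>i\<le>n. const (c i) * L i) = 0 \<longrightarrow> (\<forall>i\<le>n. c i = 0)) \<and>
       (\<exists>P C Q. projectivity n P \<and> standard_cremona n C \<and> projectivity n Q \<and>
          same_rational_map n (polar_map F) (rat_comp P (rat_comp C Q))))"
proof -
  define a where "a = (\<lambda>i j. Poly_Mapping.lookup (L i) (Poly_Mapping.single j 1))"
  have L: "lin n (a i) = L i" if "i \<le> r" for i
    using linear_form_expand[OF assms(2)[OF that]] by (simp add: lin_def a_def)
  have arr: "arrangement n r a e'" if "\<And>i. i \<le> r \<Longrightarrow> e' i \<ge> 1" for e'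
    by unfold_locales (use assms(3,4) that in \<open>simp_all add: L\<close>)
  interpret A: arrangement n r a e by (rule arr) (rule assms(5))
  interpret R: arrangement n r a "\<lambda>_. 1" by (rule arr) simp
  have F: "A.F = F" unfolding A.F_def A.L_def assms(6) by (intro prod.cong) (auto simp: L)
  have R: "R.F = F_red" unfolding R.F_def R.L_def assms(7) by (intro prod.cong) (auto simp: L)
  \<comment> \<open>Either product being homaloidal yields \<open>r = n\<close> and an inverse of
    \<open>a\<close>. This condition does not mention the exponents, so it returns both
    homaloidality statements together with the remaining conclusions.\<close>
  have *: "homaloidal n F \<and> homaloidal n F_red \<and> r = n \<and>
       (\<forall>c. (\<Sum>i\<le>n. const (c i) * L i) = 0 \<longrightarrow> (\<forall>i\<le>n. c i = 0)) \<and>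
       (\<exists>P C Q. projectivity n P \<and> standard_cremona n C \<and> projectivity n Q \<and>
          same_rational_map n (polar_map F) (rat_comp P (rat_comp C Q)))"
    if "homaloidal n F \<or> homaloidal n F_red"
  proof -
    have r: "r = n" and "\<exists>x. inverse_arrays n a x"
      using that A.homaloidal_imp_invertible R.homaloidal_imp_invertible unfolding F R by blast+
    then obtain x where x: "inverse_arrays n a x" by blast
    have sq: "square_arrangement n a e' x" if "\<And>i. i \<le> r \<Longrightarrow> e' i \<ge> 1" for e'
    proof -
      have "arrangement n r a e'" by (rule arr) (rule that)
      then show ?thesis
        using assms(1) x r unfolding square_arrangement_def square_arrangement_axioms_def by simp
    qed
    interpret AS: square_arrangement n a e x by (rule sq) (rule assms(5))
    interpret RS: square_arrangement n a "\<lambda>_. 1" x by (rule sq) simp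
    have "(\<Sum>i\<le>n. const (c i) * L i) = (\<Sum>i\<le>n. const (c i) * AS.L i)" for c
      unfolding AS.L_def by (intro sum.cong) (simp_all add: L r)
    then show ?thesis
      using AS.homaloidal_F RS.homaloidal_F AS.polar_map_decomposition AS.L_independent F R r
      by auto
  qed
  then show ?thesis by blast
qed

end
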